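(* Assume that $d^\pi(s)>0$ for all $s\in\mathcal S$ and all $\pi\in\operatorname{int}(\Delta_{\mathcal A}^{\mathcal S})$. Let $R^\star=\max_{\pi\in\Delta_{\mathcal A}^{\mathcal S}}R(\pi)$, $\Pi^\star=\{\pi\in\Delta_{\mathcal A}^{\mathcal S}:R(\pi)=R^\star\}$, and fix an initial policy $\pi_0\in\operatorname{int}(\Delta_{\mathcal A}^{\mathcal S})$. Then: 1. (Well-posedness) The Kakade gradient flow $\partial_t\pi_t=\nabla^{\mathrm K}R(\pi_t)$ started at $\pi_0$ admits a unique global solution $(\pi_t)_{t\ge0}\subseteq\operatorname{int}(\Delta_{\mathcal A}^{\mathcal S})$. 2. (Central path property) For all $t>0$, $\ \pi_t=\operatorname*{arg\,max}_{\pi\in\Delta_{\mathcal A}^{\mathcal S}}\{R(\pi)-t^{-1}D_{\mathrm K}(\pi,\pi_0)\}$. 3. (Sublinear convergence) For all $t>0$, $$0\le R^\star-R(\pi_t)\le\frac{\min_{\pi^\star\in\Pi^\star}D_{\mathrm K}(\pi^\star,\pi_0)-D_{\mathrm K}(\pi_t,\pi_0)}{t}\le\frac{\min_{\pi^\star\in\Pi^\star}D_{\mathrm K}(\pi^\star,\pi_0)}{t}.$$ 4. (Implicit bias) The flow $(\pi_t)_{t\ge0}$ converges as $t\to+\infty$ and $$\lim_{t\to+\infty}\pi_t=\pi^\star=\operatorname*{arg\,min}_{\pi\in\Pi^\star}D_{\mathrm K}(\pi,\pi_0).$$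
   Context: $\mathcal S$ (states) and $\mathcal A$ (actions) are finite nonempty sets. For a finite set $X$, $\Delta_X$ is the simplex of probability vectors on $X$. A policy is an element $\pi\in\Delta_{\mathcal A}^{\mathcal S}$ with entries $\pi(a|s)$, $\pi(\cdot|s)\in\Delta_{\mathcal A}$; $\operatorname{int}$ denotes the relative interior, so $\operatorname{int}(\Delta_{\mathcal A}^{\mathcal S})$ is the set of policies with all entries positive; $T\Delta_{\mathcal A}^{\mathcal S}=\{w\in\mathbb R^{\mathcal S\times\mathcal A}:\sum_a w(s,a)=0\ \forall s\}$. Fixed data: a transition kernel $P(s'|s,a)$, a reward vector $r\in\mathbb R^{\mathcal S\times\mathcal A}$, a discount factor $\gamma\in[0,1)$, an initial distribution $\mu\in\Delta_{\mathcal S}$. Under $\pi$ the process is $S_0\sim\mu$, $A_t\sim\pi(\cdot|S_t)$, $S_{t+1}\sim P(\cdot|S_t,A_t)$, with law $\mathbb P^{\pi,\mu}$. Define $R(\pi)=(1-\gamma)\,\mathbb E_{\mathbb P^{\pi,\mu}}[\sum_{t\ge0}\gamma^tr(S_t,A_t)]$ and $d^\pi(s)=(1-\gamma)\sum_{t\ge0}\gamma^t\,\mathbb P^{\pi,\mu}(S_t=s)$. $D_{\mathrm{KL}}(p,q)=\sum_xp(x)\log\frac{p(x)}{q(x)}$ (with $0\log0=0$), and the Kakade divergence is $D_{\mathrm K}(\pi_1,\pi_2)=\sum_sd^{\pi_1}(s)D_{\mathrm{KL}}(\pi_1(\cdot|s),\pi_2(\cdot|s))$. The Kakade metric on $\operatorname{int}(\Delta_{\mathcal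 A}^{\mathcal S})$ is $g^{\mathrm K}_\pi(w_1,w_2)=\sum_sd^\pi(s)\sum_a\frac{w_1(s,a)w_2(s,a)}{\pi(a|s)}$ for $w_1,w_2\in T\Delta_{\mathcal A}^{\mathcal S}$, and $\nabla^{\mathrm K}R(\pi)\in T\Delta_{\mathcal A}^{\mathcal S}$ is the gradient of $R$ with respect to it: $g^{\mathrm K}_\pi(\nabla^{\mathrm K}R(\pi),w)=\partial_wR(\pi)$ for all $w\in T\Delta_{\mathcal A}^{\mathcal S}$.
   Formalization: In item 4 the minimiser of D_K(·,π_0) over Π* need not be unique when optimal policies leave states unvisited; what is proved is that the limit π* is a minimiser and every minimiser agrees with it at all states s with d^{π*}(s)>0. *)

theory Defs
  imports "HOL-Analysis.Analysis" "HOL-Probability.Probability"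
begin

text \<open>
  States and actions are finite types \<open>'s\<close> and \<open>'a\<close>. A policy \<open>p\<close> is a point of \<open>real ^ 'a ^ 's\<close>
  with \<open>p $ s $ a\<close> the probability of action \<open>a\<close> in state \<open>s\<close>. The transition kernel is
  \<open>P :: 's \<Rightarrow> 'a \<Rightarrow> 's pmf\<close> and the initial distribution is \<open>\<mu> :: 's pmf\<close>.
\<close>

definition prob_simplex :: "(real ^ 'n::finite) set" where
  "prob_simplex = {p. (\<forall>i. 0 \<le> p $ i) \<and> (\<Sum>i\<in>UNIV. p $ i) = 1}"

definition policies :: "(real ^ 'a::finite ^ 's::finite) set" where
  "policies = {p. \<forall>s. p $ s \<in> prob_simplex}"

definition policy_tangent :: "(real ^ 'a::finite ^ 's::finite) set" where
  "policy_tangent = {w. \<forall>s. (\<Sum>a\<in>UNIV. w $ s $ a) = 0}"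


lemma rel_interior_policies:
  "rel_interior (policies :: (real ^ 'a::finite ^ 's::finite) set) = {p \<in> policies. \<forall>s a. 0 < p $ s $ a}"
proof -
  let ?S = "policies :: (real ^ 'a ^ 's) set"
  have conv: "convex ?S"
    by (auto simp: convex_def policies_def prob_simplex_def sum.distrib simp flip: sum_distrib_left)
  define u :: "real ^ 'a ^ 's" where "u = (\<chi> s a. 1 / real CARD('a))"
  have u: "u \<in> ?S" by (simp add: u_def policies_def prob_simplex_def)
  have "p \<in> policies \<and> (\<forall>s a. 0 < p $ s $ a)" if p: "p \<in> rel_interior ?S" for p
  proof -
    have pS: "p \<in> ?S" using p rel_interior_subset by blast
    obtain e where e: "e > 1" "(1 - e) *\<^sub>R u + e *\<^sub>R p \<in> ?S"
      using p u convex_rel_interior_iff[OF conv] by blast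
    have "0 < p $ s $ a" for s a
    proof -
      have "0 \<le> (1 - e) / real CARD('a) + e * p $ s $ a"
        using e(2) by (auto simp: policies_def prob_simplex_def u_def)
      moreover have "(1 - e) / real CARD('a) < 0" using e(1) by (simp add: divide_neg_pos)
      ultimately have "0 < e * p $ s $ a" by linarith
      then show ?thesis using e(1) by (simp add: zero_less_mult_iff)
    qed
    then show ?thesis using pS by simp
  qed
  moreover have "p \<in> rel_interior ?S" if p: "p \<in> ?S" and pos: "\<And>s a. 0 < p $ s $ a" for p
  proof -
    have "\<exists>e>1. (1 - e) *\<^sub>R x + e *\<^sub>R p \<in> ?S" if x: "x \<in> ?S" for x
    proof -
      define m where "m = Min (range (\<lambda>(s, a). p $ s $ a))"
      have m: "0 < m" "\<And>s a. m \<le> p $ s $ a"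
        using pos by (auto simp: m_def intro!: Min_le)
      have le: "x $ s $ a \<le> 1" for s a
      proof -
        have "x $ s $ a \<le> (\<Sum>a\<in>UNIV. x $ s $ a)"
          using x by (intro member_le_sum) (auto simp: policies_def prob_simplex_def)
        then show ?thesis using x by (simp add: policies_def prob_simplex_def)
      qed
      have nn: "0 \<le> (1 - (1 + m)) * x $ s $ a + (1 + m) * p $ s $ a" for s a
      proof -
        have "m * x $ s $ a \<le> m * 1" using le m by (intro mult_left_mono) auto
        also have "\<dots> \<le> p $ s $ a" using m by simp
        also have "\<dots> \<le> (1 + m) * p $ s $ a" using m pos[of s a] by (simp add: algebra_simps)
        finally show ?thesis by simp
      qed
      have "(1 - (1 + m)) *\<^sub>R x + (1 + m) *\<^sub>R p \<in> ?S"
        using x p nn by (auto simp: policies_def prob_simplex_def sum.distrib sum_subtractf simp flip: sum_distrib_left)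
      then show ?thesis using m by (intro exI[of _ "1 + m"]) auto
    qed
    then show ?thesis
      using convex_rel_interior_iff[OF conv] u by blast
  qed
  ultimately show ?thesis by auto
qed

text \<open>
  Conditional law of \<open>(S\<^sub>t, A\<^sub>t)\<close> given \<open>(S\<^sub>i, A\<^sub>i) = \<omega> i\<close> for \<open>i < t\<close>. The function
  \<open>embed_pmf\<close> is meaningful only on probability vectors, so this and everything built on it is
  meaningful only for \<open>p \<in> policies\<close>.
\<close>

definition mdp_step ::
  "('s \<Rightarrow> 'a \<Rightarrow> 's pmf) \<Rightarrow> 's pmf \<Rightarrow> real ^ 'a ^ 's \<Rightarrow> nat \<Rightarrow> (nat \<Rightarrow> 's \<times> 'a) \<Rightarrow> ('s::finite \<times> 'a::finite) pmf"
where
  "mdp_step P \<mu> p t \<omega> =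
     bind_pmf (case t of 0 \<Rightarrow> \<mu> | Suc i \<Rightarrow> P (fst (\<omega> i)) (snd (\<omega> i)))
       (\<lambda>s. map_pmf (Pair s) (embed_pmf (\<lambda>a. p $ s $ a)))"

lemma Ionescu_Tulcea_mdp:
  fixes P :: "'s::finite \<Rightarrow> 'a::finite \<Rightarrow> 's pmf"
  shows "Ionescu_Tulcea (\<lambda>t \<omega>. measure_pmf (mdp_step P \<mu> p t \<omega>)) (\<lambda>_. count_space UNIV)"
proof
  fix t :: nat
  show "(\<lambda>\<omega>. measure_pmf (mdp_step P \<mu> p t \<omega>))
    \<in> measurable (PiM {0..<t} (\<lambda>_. count_space UNIV)) (subprob_algebra (count_space UNIV))"
  proof (cases t)
    case 0
    then show ?thesis
      by (simp add: mdp_step_def measure_pmf_in_subprob_algebra)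
  next
    case (Suc i)
    let ?f = "\<lambda>z. measure_pmf (bind_pmf (P (fst z) (snd z))
       (\<lambda>s. map_pmf (Pair s) (embed_pmf (\<lambda>a. p $ s $ a))))"
    have "(\<lambda>\<omega>. \<omega> i) \<in> measurable (PiM {0..<t} (\<lambda>_. count_space UNIV)) (count_space (UNIV :: ('s \<times> 'a) set))"
      using Suc by (intro measurable_component_singleton) auto
    moreover have "?f \<in> measurable (count_space UNIV) (subprob_algebra (count_space UNIV))"
      by (simp add: measure_pmf_in_subprob_algebra)
    ultimately have "(\<lambda>\<omega>. ?f (\<omega> i))
      \<in> measurable (PiM {0..<t} (\<lambda>_. count_space UNIV)) (subprob_algebra (count_space UNIV))"
      by (rule measurable_compose)
    then show ?thesis
      by (simp add: mdp_step_def Suc)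
  qed
qed

text \<open>The law on trajectories \<open>\<omega> :: nat \<Rightarrow> 's \<times> 'a\<close>, with \<open>S\<^sub>t = fst (\<omega> t)\<close> and \<open>A\<^sub>t = snd (\<omega> t)\<close>.\<close>

definition mdp_law ::
  "('s \<Rightarrow> 'a \<Rightarrow> 's pmf) \<Rightarrow> 's pmf \<Rightarrow> real ^ 'a ^ 's \<Rightarrow> (nat \<Rightarrow> 's::finite \<times> 'a::finite) measure"
where
  "mdp_law P \<mu> p =
     projective_family.lim UNIV
       (Ionescu_Tulcea.CI (\<lambda>t \<omega>. measure_pmf (mdp_step P \<mu> p t \<omega>)) (\<lambda>_. count_space UNIV))
       (\<lambda>_. count_space UNIV)"



lemma emeasure_mdp_law_cylinder:
  fixes P :: "'s::finite \<Rightarrow> 'a::finite \<Rightarrow> 's pmf"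
  shows "emeasure (mdp_law P \<mu> p) {\<omega>. \<forall>t<n. \<omega> t = z t} = (\<Prod>t<n. pmf (mdp_step P \<mu> p t z) (z t))"
proof -
  let ?M = "\<lambda>_::nat. count_space (UNIV :: ('s \<times> 'a) set)"
  interpret IT: Ionescu_Tulcea "\<lambda>t \<omega>. measure_pmf (mdp_step P \<mu> p t \<omega>)" ?M
    by (rule Ionescu_Tulcea_mdp)
  have sing: "{restrict z {0..<n}} = (\<Pi>\<^sub>E t\<in>{0..<n}. {z t})" for n
    by (auto simp: PiE_def Pi_iff extensional_def fun_eq_iff restrict_def)
  have sets[measurable]: "{restrict z {0..<n}} \<in> sets (PiM {0..<n} ?M)" for n
    unfolding sing by (intro sets_PiM_I_finite) auto
  have C: "emeasure (IT.C 0 n (\<lambda>_. undefined)) {restrict z {0..<n}} = (\<Prod>t<n. pmf (mdp_step P \<mu> p t z) (z t))"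
  proof (induction n)
    case 0
    then show ?case using sets[of 0] by (simp add: restrict_def)
  next
    case (Suc n)
    let ?c = "ennreal (pmf (mdp_step P \<mu> p n z) (z n))"
    have u: "(\<lambda>_. undefined) \<in> space (PiM {0..<0} ?M)" by (simp add: space_PiM)
    have eP: "emeasure (IT.eP n \<omega>) {restrict z {0..<Suc n}} = ?c * indicator {restrict z {0..<n}} \<omega>"
      if \<omega>: "\<omega> \<in> space (PiM {0..<n} ?M)" for \<omega>
    proof -
      have ext: "\<omega> \<in> extensional {0..<n}" using \<omega> by (simp add: space_PiM PiE_def)
      have step: "mdp_step P \<mu> p n (restrict z {0..<n}) = mdp_step P \<mu> p n z"
        by (cases n) (auto simp: mdp_step_def)
      have eq: "(\<lambda>x. fun_upd \<omega> n x) -` {restrict z {0..<Suc n}} = (if \<omega> = restrict z {0..<n} then {z n} else {})"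
      proof -
        have "fun_upd \<omega> n x = restrict z {0..<Suc n} \<longleftrightarrow> \<omega> = restrict z {0..<n} \<and> x = z n" for x
        proof
          assume *: "fun_upd \<omega> n x = restrict z {0..<Suc n}"
          have "\<omega> t = restrict z {0..<n} t" for t
            using fun_cong[OF *, of t] ext by (cases "t < n") (auto simp: extensional_def)
          then show "\<omega> = restrict z {0..<n} \<and> x = z n"
            using fun_cong[OF *, of n] by auto
        qed (auto simp: fun_eq_iff)
        then show ?thesis unfolding vimage_def by (simp del: fun_upd_apply)
      qed
      show ?thesis
        by (subst IT.emeasure_eP[OF \<omega> sets]) (auto simp: eq step emeasure_pmf_single)
    qed
    have "emeasure (IT.C 0 (Suc n) (\<lambda>_. undefined)) {restrict z {0..<Suc n}} =
      (\<integral>\<^sup>+\<omega>. emeasure (IT.eP n \<omega>) {restrict z {0..<Suc n}} \<partial>IT.C 0 n (\<lambda>_. undefined))"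
      using IT.space_C[OF u, of n] IT.sets_C[OF u, of n] IT.measurable_eP[of n]
      by (simp, subst emeasure_bind[where N = "PiM {0..<Suc n} ?M"])
         (auto simp: space_PiM measurable_cong_sets[OF IT.sets_C[OF u]] intro!: sets)
    also have "\<dots> = (\<integral>\<^sup>+\<omega>. ?c * indicator {restrict z {0..<n}} \<omega> \<partial>IT.C 0 n (\<lambda>_. undefined))"
      using IT.space_C[OF u, of n] by (intro nn_integral_cong eP) simp
    also have "\<dots> = ?c * emeasure (IT.C 0 n (\<lambda>_. undefined)) {restrict z {0..<n}}"
      using IT.sets_C[OF u, of n] by (intro nn_integral_cmult_indicator) (simp add: sets)
    also have "\<dots> = (\<Prod>t<Suc n. pmf (mdp_step P \<mu> p t z) (z t))"
      by (simp only: Suc) (simp add: ennreal_mult prod_nonneg mult.commute)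
    finally show ?case .
  qed
  have "{\<omega>. \<forall>t<n. \<omega> t = z t} = prod_emb UNIV ?M {0..<n} {restrict z {0..<n}}"
    by (auto simp: prod_emb_def fun_eq_iff space_PiM restrict_def) metis
  then have "emeasure IT.PF.lim {\<omega>. \<forall>t<n. \<omega> t = z t} = emeasure (IT.CI {0..<n}) {restrict z {0..<n}}"
    by (simp only:) (rule IT.lim[OF _ sets], simp)
  also have "\<dots> = emeasure (IT.C 0 n (\<lambda>_. undefined)) (prod_emb {0..<n} ?M {0..<n} {restrict z {0..<n}})"
    by (rule IT.emeasure_CI[OF subset_refl sets])
  also have "prod_emb {0..<n} ?M {0..<n} {restrict z {0..<n}} = {restrict z {0..<n}}"
    by (intro prod_emb_id) (auto simp: space_PiM)
  finally show ?thesis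
    by (simp only: C mdp_law_def)
qed

lemma pmf_mdp_step:
  assumes "p \<in> policies"
  shows "pmf (mdp_step P \<mu> p t \<omega>) (s, a) =
    pmf (case t of 0 \<Rightarrow> \<mu> | Suc i \<Rightarrow> P (fst (\<omega> i)) (snd (\<omega> i))) s * p $ s $ a"
proof -
  have emb: "pmf (embed_pmf (\<lambda>a. p $ s $ a)) a = p $ s $ a" for s a
    using assms
    by (intro pmf_embed_pmf) (auto simp: policies_def prob_simplex_def nn_integral_count_space_finite sum_ennreal)
  have "pmf (map_pmf (Pair s') (embed_pmf (\<lambda>a. p $ s' $ a))) (s, a) = indicator {s} s' * p $ s $ a" for s'
  proof (cases "s' = s")
    case True
    then show ?thesis by (simp add: pmf_map_inj' inj_on_def emb)
  next
    case False
    then show ?thesis by (auto simp: pmf_eq_0_set_pmf)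
  qed
  then show ?thesis
    by (simp add: mdp_step_def pmf_bind measure_pmf_single)
qed

definition reward ::
  "('s \<Rightarrow> 'a \<Rightarrow> 's pmf) \<Rightarrow> ('s \<Rightarrow> 'a \<Rightarrow> real) \<Rightarrow> real \<Rightarrow> 's pmf \<Rightarrow> real ^ 'a::finite ^ 's::finite \<Rightarrow> real"
where
  "reward P r \<gamma> \<mu> p =
     (1 - \<gamma>) * (\<integral>\<omega>. (\<Sum>t. \<gamma> ^ t * r (fst (\<omega> t)) (snd (\<omega> t))) \<partial>mdp_law P \<mu> p)"

definition state_dist ::
  "('s \<Rightarrow> 'a \<Rightarrow> 's pmf) \<Rightarrow> real \<Rightarrow> 's pmf \<Rightarrow> real ^ 'a::finite ^ 's::finite \<Rightarrow> 's \<Rightarrow> real"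
where
  "state_dist P \<gamma> \<mu> p s =
     (1 - \<gamma>) * (\<Sum>t. \<gamma> ^ t * \<P>(\<omega> in mdp_law P \<mu> p. fst (\<omega> t) = s))"

text \<open>
  Real-valued; agrees with the usual Kullback-Leibler divergence when \<open>q\<close> has positive entries
  (a vanishing \<open>p $ x\<close> contributes 0). It is only used with such \<open>q\<close>.
\<close>

definition KL_div :: "real ^ 'n::finite \<Rightarrow> real ^ 'n \<Rightarrow> real" where
  "KL_div p q = (\<Sum>x\<in>UNIV. p $ x * ln (p $ x / q $ x))"

definition kakade_div ::
  "('s \<Rightarrow> 'a \<Rightarrow> 's pmf) \<Rightarrow> real \<Rightarrow> 's pmf \<Rightarrow> real ^ 'a::finite ^ 's::finite \<Rightarrow> real ^ 'a ^ 's \<Rightarrow> real"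
where
  "kakade_div P \<gamma> \<mu> p q = (\<Sum>s\<in>UNIV. state_dist P \<gamma> \<mu> p s * KL_div (p $ s) (q $ s))"

definition kakade_metric ::
  "('s \<Rightarrow> 'a \<Rightarrow> 's pmf) \<Rightarrow> real \<Rightarrow> 's pmf \<Rightarrow> real ^ 'a::finite ^ 's::finite \<Rightarrow>
   real ^ 'a ^ 's \<Rightarrow> real ^ 'a ^ 's \<Rightarrow> real"
where
  "kakade_metric P \<gamma> \<mu> p v w =
     (\<Sum>s\<in>UNIV. state_dist P \<gamma> \<mu> p s * (\<Sum>a\<in>UNIV. v $ s $ a * w $ s $ a / p $ s $ a))"

definition kakade_gradient ::
  "('s \<Rightarrow> 'a \<Rightarrow> 's pmf) \<Rightarrow> ('s \<Rightarrow> 'a \<Rightarrow> real) \<Rightarrow> real \<Rightarrow> 's pmf \<Rightarrow>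
   real ^ 'a::finite ^ 's::finite \<Rightarrow> real ^ 'a ^ 's"
where
  "kakade_gradient P r \<gamma> \<mu> p =
     (THE v. v \<in> policy_tangent \<and>
        (\<forall>w\<in>policy_tangent.
           ((\<lambda>h. reward P r \<gamma> \<mu> (p + h *\<^sub>R w)) has_real_derivative kakade_metric P \<gamma> \<mu> p v w) (at 0)))"

definition kakade_flow ::
  "('s \<Rightarrow> 'a \<Rightarrow> 's pmf) \<Rightarrow> ('s \<Rightarrow> 'a \<Rightarrow> real) \<Rightarrow> real \<Rightarrow> 's pmf \<Rightarrow>
   real ^ 'a::finite ^ 's::finite \<Rightarrow> (real \<Rightarrow> real ^ 'a ^ 's) \<Rightarrow> bool"
where
  "kakade_flow P r \<gamma> \<mu> p0 \<phi> \<longleftrightarrow>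
     \<phi> 0 = p0 \<and>
     (\<forall>t\<ge>0. \<phi> t \<in> rel_interior policies \<and>
       (\<phi> has_vector_derivative kakade_gradient P r \<gamma> \<mu> (\<phi> t)) (at t within {0..}))"

definition max_reward ::
  "('s::finite \<Rightarrow> 'a::finite \<Rightarrow> 's pmf) \<Rightarrow> ('s \<Rightarrow> 'a \<Rightarrow> real) \<Rightarrow> real \<Rightarrow> 's pmf \<Rightarrow> real"
where
  "max_reward P r \<gamma> \<mu> = (GREATEST x. x \<in> reward P r \<gamma> \<mu> ` policies)"

definition optimal_policies ::
  "('s::finite \<Rightarrow> 'a::finite \<Rightarrow> 's pmf) \<Rightarrow> ('s \<Rightarrow> 'a \<Rightarrow> real) \<Rightarrow> real \<Rightarrow> 's pmf \<Rightarrow> (real ^ 'a ^ 's) set"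
where
  "optimal_policies P r \<gamma> \<mu> = {p \<in> policies. reward P r \<gamma> \<mu> p = max_reward P r \<gamma> \<mu>}"

definition min_optimal_div ::
  "('s::finite \<Rightarrow> 'a::finite \<Rightarrow> 's pmf) \<Rightarrow> ('s \<Rightarrow> 'a \<Rightarrow> real) \<Rightarrow> real \<Rightarrow> 's pmf \<Rightarrow> real ^ 'a ^ 's \<Rightarrow> real"
where
  "min_optimal_div P r \<gamma> \<mu> p0 =
     (LEAST x. x \<in> (\<lambda>p. kakade_div P \<gamma> \<mu> p p0) ` optimal_policies P r \<gamma> \<mu>)"

end

theory Submission
  imports Defs
begin

text \<open>
  The flow is solved explicitly. Its vector field is \<open>\<pi>(a|s) A(s, a)\<close> with \<open>A\<close> the advantage function
  of \<open>\<pi>\<close>: by the performance difference lemma the derivative of the reward in direction \<open>w\<close> is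
  \<open>\<Sum>s. d(s) \<Sum>a. w(s, a) A(s, a)\<close>, and the weights \<open>d(s)\<close> are also those of the metric
  (\<open>kakade_gradient_eq\<close>). So along the flow, \<open>ln \<pi>\<^sub>t\<close> has derivative \<open>A\<close>. If \<open>U\<^sub>t\<close> denotes the time
  integral of the value functions, then \<open>ln (\<pi>\<^sub>t / \<pi>\<^sub>0) = t r + \<gamma> P U\<^sub>t - U\<^sub>t\<close>, and normalisation
  of \<open>\<pi>\<^sub>t\<close> turns this into the equation
  \<open>U\<^sub>t(s) = ln (\<Sum>a. \<pi>\<^sub>0(a|s) exp (t r(s, a) + \<gamma> (P U\<^sub>t)(s, a)))\<close>.
  This is the Bellman equation of the entropy-regularised problem. Its right-hand side is a sup-norm
  contraction, so \<open>U\<^sub>t\<close>, and hence the flow, is unique (\<open>kakade_flow_unique\<close>). Conversely, the fixed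
  point is differentiable in \<open>t\<close> with the value of the resulting policy as derivative
  (\<open>soft_value_has_derivative\<close>), so the soft policies do solve the flow, for all times.

  The rest follows from one identity. Rewriting the reward with \<open>U\<^sub>t\<close> as a potential gives
  \<open>t R(\<pi>) - D(\<pi>, \<pi>\<^sub>0) = const - D(\<pi>, \<pi>\<^sub>t)\<close> for every policy \<open>\<pi>\<close> (\<open>regularised_reward_eq\<close>), where
  the constant depends on \<open>t\<close> only. The right-hand side is maximal exactly at \<open>\<pi>\<^sub>t\<close>, which is the
  central path property. Subtracting the case \<open>\<pi> = \<pi>\<^sub>t\<close> gives
  \<open>t (R(\<pi>) - R(\<pi>\<^sub>t)) = D(\<pi>, \<pi>\<^sub>0) - D(\<pi>\<^sub>t, \<pi>\<^sub>0) - D(\<pi>, \<pi>\<^sub>t)\<close>, and an optimal \<open>\<pi>\<close> yields the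
  rate. It also yields \<open>D(\<pi>, \<pi>\<^sub>t) \<le> D(\<pi>, \<pi>\<^sub>0) - D(\<pi>\<^sub>t, \<pi>\<^sub>0)\<close>; if \<open>\<pi>\<close> is an optimal policy of
  least divergence, the right-hand side tends to 0 along any convergent sequence of times, so the
  path approaches \<open>\<pi>\<close> in every state that \<open>\<pi>\<close> visits (\<open>path_cluster_point\<close>).

  Optimal policies need not visit every state, which leaves convergence open in the remaining ones.
  But the fixed-point equation for \<open>U\<^sub>t\<close> does not mention the initial distribution. Running the
  argument for the uniform initial distribution, under which every policy visits every state, shows
  that the path converges (\<open>path_convergent\<close>); the limit is then identified with the original
  distribution.
\<close>

section \<open>State occupancy of a policy\<close>

lemma sum_UNIV_prod:
  "(\<Sum>x\<in>UNIV. f x) = (\<Sum>s\<in>UNIV. \<Sum>a\<in>UNIV. f (s :: 's::finite, a :: 'a::finite))"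
  by (simp add: sum.cartesian_product split_def)

lemma space_mdp_law [simp]: "space (mdp_law P \<mu> p) = UNIV"
  and sets_mdp_law [measurable_cong]:
    "sets (mdp_law P \<mu> p) = sets (PiM UNIV (\<lambda>_. count_space (UNIV :: ('s::finite \<times> 'a::finite) set)))"
  for p :: "real ^ 'a::finite ^ 's::finite"
proof -
  interpret IT: Ionescu_Tulcea "\<lambda>t \<omega>. measure_pmf (mdp_step P \<mu> p t \<omega>)" "\<lambda>_. count_space UNIV"
    by (rule Ionescu_Tulcea_mdp)
  show "space (mdp_law P \<mu> p) = UNIV"
    unfolding mdp_law_def by (subst IT.PF.space_lim) (simp add: space_PiM)
  show "sets (mdp_law P \<mu> p) = sets (PiM UNIV (\<lambda>_. count_space (UNIV :: ('s \<times> 'a) set)))"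
    unfolding mdp_law_def by (rule IT.PF.sets_lim)
qed

lemma prob_space_mdp_law: "prob_space (mdp_law P \<mu> p)"
  using emeasure_mdp_law_cylinder[of P \<mu> p 0] by (intro prob_spaceI) simp

lemma sets_mdp_law_cylinder [simp]:
  fixes p :: "real ^ 'a::finite ^ 's::finite"
  shows "{\<omega>. \<forall>t<n. \<omega> t = z t} \<in> sets (mdp_law P \<mu> p)"
proof -
  have "Measurable.pred (mdp_law P \<mu> p) (\<lambda>\<omega>. \<forall>t<n. \<omega> t = z t)"
    by measurable
  then show ?thesis by (simp add: pred_def)
qed

lemma measure_mdp_law_cylinder_Suc:
  "measure (mdp_law P \<mu> p) {\<omega>. \<forall>t<Suc n. \<omega> t = z t} =
   measure (mdp_law P \<mu> p) {\<omega>. \<forall>t<n. \<omega> t = z t} * pmf (mdp_step P \<mu> p n z) (z n)"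
  unfolding measure_def emeasure_mdp_law_cylinder
  by (simp add: prod_nonneg)

text \<open>
  The cylinders that prescribe the whole history up to time \<open>t\<close> refine the event that only the
  pair at time \<open>t\<close> is prescribed; summing the cylinder formula over these histories gives the
  Markov property, since the one-step law depends on the last pair only.
\<close>

lemma measure_mdp_law_markov:
  fixes p :: "real ^ 'a::finite ^ 's::finite"
  shows "measure (mdp_law P \<mu> p) {\<omega>. \<omega> t = x \<and> \<omega> (Suc t) = y} =
    measure (mdp_law P \<mu> p) {\<omega>. \<omega> t = x} * pmf (mdp_step P \<mu> p (Suc t) (\<lambda>_. x)) y"
proof -
  interpret prob_space "mdp_law P \<mu> p" by (rule prob_space_mdp_law)
  let ?M = "mdp_law P \<mu> p"
  \<comment> \<open>Histories up to time \<open>t\<close> that end in \<open>x\<close>; extensionality makes this set finite.\<close>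
  define Z where "Z = {z \<in> PiE {..t} (\<lambda>_. UNIV). z t = x}"
  define C where "C n z = {\<omega> :: nat \<Rightarrow> 's \<times> 'a. \<forall>i<n. \<omega> i = z i}" for n z
  have finZ: "finite Z"
    unfolding Z_def by (rule finite_subset[of _ "PiE {..t} (\<lambda>_. UNIV)"]) (auto intro: finite_PiE)
  have eq: "z = z'" if "z \<in> Z" "z' \<in> Z" "\<forall>i\<le>t. z i = z' i" for z z'
    using that by (auto simp: Z_def intro!: PiE_ext[of z "{..t}" _ z'])
  have disj: "disjoint_family_on (\<lambda>z. C (Suc t) z) Z"
    unfolding disjoint_family_on_def
  proof (intro ballI impI equals0I)
    fix z z' \<omega> assume *: "z \<in> Z" "z' \<in> Z" "z \<noteq> z'" "\<omega> \<in> C (Suc t) z \<inter> C (Suc t) z'"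
    then have "\<forall>i\<le>t. z i = z' i" by (simp add: C_def less_Suc_eq_le) metis
    with * show False using eq by blast
  qed
  \<comment> \<open>The refined cylinders inherit disjointness from the coarser ones.\<close>
  have sub: "C (Suc (Suc t)) (z(Suc t := y)) \<subseteq> C (Suc t) z" for z
  proof
    fix \<omega> assume *: "\<omega> \<in> C (Suc (Suc t)) (z(Suc t := y))"
    have "\<omega> i = z i" if "i < Suc t" for i
    proof -
      have "\<forall>i<Suc (Suc t). \<omega> i = (z(Suc t := y)) i"
        using * by (simp only: C_def mem_Collect_eq)
      from this[rule_format, of i] that show ?thesis by simp
    qed
    then show "\<omega> \<in> C (Suc t) z" by (simp add: C_def)
  qed
  have disj': "disjoint_family_on (\<lambda>z. C (Suc (Suc t)) (z(Suc t := y))) Z"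
    using disj sub unfolding disjoint_family_on_def by blast
  have ex: "\<exists>z\<in>Z. \<forall>i\<le>t. \<omega> i = z i" if "\<omega> t = x" for \<omega>
    using that by (intro bexI[of _ "restrict \<omega> {..t}"]) (auto simp: Z_def)
  have U1: "{\<omega>. \<omega> t = x} = (\<Union>z\<in>Z. C (Suc t) z)"
    using ex by (auto simp: C_def Z_def less_Suc_eq_le)
  have U2: "{\<omega>. \<omega> t = x \<and> \<omega> (Suc t) = y} = (\<Union>z\<in>Z. C (Suc (Suc t)) (z(Suc t := y)))"
  proof (intro equalityI subsetI)
    fix \<omega> assume *: "\<omega> \<in> {\<omega>. \<omega> t = x \<and> \<omega> (Suc t) = y}"
    then obtain z where "z \<in> Z" "\<forall>i\<le>t. \<omega> i = z i" using ex by blast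
    with * show "\<omega> \<in> (\<Union>z\<in>Z. C (Suc (Suc t)) (z(Suc t := y)))"
      by (intro UN_I[of z]) (simp_all add: C_def less_Suc_eq_le le_Suc_eq)
  next
    fix \<omega> assume "\<omega> \<in> (\<Union>z\<in>Z. C (Suc (Suc t)) (z(Suc t := y)))"
    then obtain z where z: "z \<in> Z" "\<omega> \<in> C (Suc (Suc t)) (z(Suc t := y))" by blast
    then have "\<omega> \<in> C (Suc t) z" using sub by blast
    with z show "\<omega> \<in> {\<omega>. \<omega> t = x \<and> \<omega> (Suc t) = y}"
      by (simp add: C_def Z_def)
  qed
  have ev: "C n z \<in> events" for n z
    unfolding C_def by (rule sets_mdp_law_cylinder)
  have step: "measure ?M (C (Suc (Suc t)) (z(Suc t := y))) =
      measure ?M (C (Suc t) z) * pmf (mdp_step P \<mu> p (Suc t) (\<lambda>_. x)) y" if "z \<in> Z" for z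
  proof -
    have "C (Suc t) (z(Suc t := y)) = C (Suc t) z" by (auto simp: C_def)
    moreover have "mdp_step P \<mu> p (Suc t) (z(Suc t := y)) = mdp_step P \<mu> p (Suc t) (\<lambda>_. x)"
      using that by (simp add: mdp_step_def Z_def)
    ultimately show ?thesis
      using measure_mdp_law_cylinder_Suc[of P \<mu> p "Suc t" "z(Suc t := y)"] by (simp add: C_def)
  qed
  have "measure ?M {\<omega>. \<omega> t = x \<and> \<omega> (Suc t) = y} = (\<Sum>z\<in>Z. measure ?M (C (Suc (Suc t)) (z(Suc t := y))))"
    unfolding U2 using finZ disj' ev by (intro finite_measure_finite_Union) blast+
  also have "\<dots> = (\<Sum>z\<in>Z. measure ?M (C (Suc t) z)) * pmf (mdp_step P \<mu> p (Suc t) (\<lambda>_. x)) y"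
    by (simp add: step sum_distrib_right)
  also have "(\<Sum>z\<in>Z. measure ?M (C (Suc t) z)) = measure ?M {\<omega>. \<omega> t = x}"
    unfolding U1 using finZ disj ev by (intro finite_measure_finite_Union[symmetric]) blast+
  finally show ?thesis .
qed

lemma measure_mdp_law_sum:
  fixes f :: "(nat \<Rightarrow> 's::finite \<times> 'a::finite) \<Rightarrow> 'b::finite" and p :: "real ^ 'a ^ 's"
  assumes [measurable]: "f \<in> measurable (mdp_law P \<mu> p) (count_space UNIV)" "Measurable.pred (mdp_law P \<mu> p) Q"
  shows "measure (mdp_law P \<mu> p) {\<omega>. Q \<omega>} = (\<Sum>x\<in>UNIV. measure (mdp_law P \<mu> p) {\<omega>. f \<omega> = x \<and> Q \<omega>})"
proof -
  interpret prob_space "mdp_law P \<mu> p" by (rule prob_space_mdp_law)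
  have m: "{\<omega>. f \<omega> = x \<and> Q \<omega>} \<in> events" for x
  proof -
    have "Measurable.pred (mdp_law P \<mu> p) (\<lambda>\<omega>. f \<omega> = x \<and> Q \<omega>)" by measurable
    then show ?thesis by (simp add: pred_def)
  qed
  have "{\<omega>. Q \<omega>} = (\<Union>x\<in>UNIV. {\<omega>. f \<omega> = x \<and> Q \<omega>})" by auto
  then show ?thesis
    using m by (simp only:) (rule finite_measure_finite_Union, auto simp: disjoint_family_on_def)
qed

definition state_prob ::
  "('s \<Rightarrow> 'a \<Rightarrow> 's pmf) \<Rightarrow> 's pmf \<Rightarrow> real ^ 'a::finite ^ 's::finite \<Rightarrow> nat \<Rightarrow> 's \<Rightarrow> real"
where
  "state_prob P \<mu> p t s = measure (mdp_law P \<mu> p) {\<omega>. fst (\<omega> t) = s}"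

lemma state_prob_nonneg [simp]: "0 \<le> state_prob P \<mu> p t s"
  by (simp add: state_prob_def)

lemma measurable_coord [measurable]:
  fixes p :: "real ^ 'a::finite ^ 's::finite"
  shows "(\<lambda>\<omega>. \<omega> t) \<in> measurable (mdp_law P \<mu> p) (count_space UNIV)"
  by measurable

text \<open>
  Discrete events about the pair at one time are measurable; with a predicate for \<open>f\<close>, this is the
  form in which the conditioning lemma below consumes them.
\<close>

lemma measurable_coord_fun [simp]:
  fixes p :: "real ^ 'a::finite ^ 's::finite"
  shows "(\<lambda>\<omega>. f (\<omega> t)) \<in> measurable (mdp_law P \<mu> p) (count_space UNIV)"
  by (rule measurable_compose[OF measurable_coord]) simp

text \<open>
  Whatever the past is, the action is drawn from \<open>p $ s\<close> once the state \<open>s\<close> is known, so the joint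
  law of state and action at a fixed time has a factor depending on \<open>s\<close> alone. Summing over the
  actions identifies that factor as the state marginal.
\<close>

lemma pair_prob_eq:
  fixes p :: "real ^ 'a::finite ^ 's::finite"
  assumes p: "p \<in> policies"
  shows "measure (mdp_law P \<mu> p) {\<omega>. \<omega> t = (s, a)} = state_prob P \<mu> p t s * p $ s $ a"
proof -
  have sum1: "(\<Sum>a\<in>UNIV. p $ s $ a) = 1" for s
    using p by (simp add: policies_def prob_simplex_def)
  have fact: "\<exists>\<rho>. \<forall>s a. measure (mdp_law P \<mu> p) {\<omega>. \<omega> t = (s, a)} = \<rho> s * p $ s $ a"
  proof (cases t)
    case 0
    have "measure (mdp_law P \<mu> p) {\<omega>. \<omega> 0 = (s, a)} = pmf \<mu> s * p $ s $ a" for s a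
      using measure_mdp_law_cylinder_Suc[of P \<mu> p 0 "\<lambda>_. (s, a)"] p
        prob_space.prob_space[OF prob_space_mdp_law[of P \<mu> p]]
      by (simp add: pmf_mdp_step)
    then show ?thesis using 0 by blast
  next
    case (Suc i)
    have "measure (mdp_law P \<mu> p) {\<omega>. \<omega> t = (s, a)} =
        (\<Sum>x\<in>UNIV. measure (mdp_law P \<mu> p) {\<omega>. \<omega> i = x} * pmf (P (fst x) (snd x)) s) * p $ s $ a" for s a
      using measure_mdp_law_sum[OF measurable_coord[of i P \<mu> p] measurable_coord_fun[of "\<lambda>x. x = (s, a)" t]] p
      by (simp add: Suc measure_mdp_law_markov pmf_mdp_step sum_distrib_right mult.assoc)
    then show ?thesis
      by (intro exI[of _ "\<lambda>s. \<Sum>x\<in>UNIV. measure (mdp_law P \<mu> p) {\<omega>. \<omega> i = x} * pmf (P (fst x) (snd x)) s"]) blast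
  qed
  \<comment> \<open>Only the existence of a factor depending on \<open>s\<close> alone is kept.\<close>
  then obtain \<rho> where \<rho>: "\<And>s a. measure (mdp_law P \<mu> p) {\<omega>. \<omega> t = (s, a)} = \<rho> s * p $ s $ a"
    by blast
  have "state_prob P \<mu> p t s = (\<Sum>a\<in>UNIV. measure (mdp_law P \<mu> p) {\<omega>. \<omega> t = (s, a)})"
    using measure_mdp_law_sum[OF measurable_coord_fun[of snd t P \<mu> p]
      measurable_coord_fun[of "\<lambda>x. fst x = s" t]]
    by (simp add: state_prob_def prod_eq_iff conj_commute)
  also have "\<dots> = \<rho> s" by (simp add: \<rho> sum1 flip: sum_distrib_left)
  finally show ?thesis by (simp add: \<rho>)
qed

lemma state_prob_0:
  assumes p: "p \<in> policies"
  shows "state_prob P \<mu> p 0 s = pmf \<mu> s"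
proof -
  have sum1: "(\<Sum>a\<in>UNIV. p $ s $ a) = 1"
    using p by (simp add: policies_def prob_simplex_def)
  have "state_prob P \<mu> p 0 s = (\<Sum>a\<in>UNIV. measure (mdp_law P \<mu> p) {\<omega>. \<omega> 0 = (s, a)})"
    using sum1 by (simp add: pair_prob_eq[OF p] flip: sum_distrib_left)
  also have "\<dots> = (\<Sum>a\<in>UNIV. pmf \<mu> s * p $ s $ a)"
    using measure_mdp_law_cylinder_Suc[of P \<mu> p 0 "\<lambda>_. (s, _)"] p
        prob_space.prob_space[OF prob_space_mdp_law[of P \<mu> p]]
    by (simp add: pmf_mdp_step)
  finally show ?thesis using sum1 by (simp flip: sum_distrib_left)
qed

lemma state_prob_Suc:
  assumes p: "p \<in> policies"
  shows "state_prob P \<mu> p (Suc t) s' =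
    (\<Sum>s\<in>UNIV. \<Sum>a\<in>UNIV. state_prob P \<mu> p t s * p $ s $ a * pmf (P s a) s')"
proof -
  have sum1: "(\<Sum>a\<in>UNIV. p $ s $ a) = 1" for s
    using p by (simp add: policies_def prob_simplex_def)
  have "state_prob P \<mu> p (Suc t) s' = (\<Sum>a'\<in>UNIV. measure (mdp_law P \<mu> p) {\<omega>. \<omega> (Suc t) = (s', a')})"
    using sum1 by (simp add: pair_prob_eq[OF p] flip: sum_distrib_left)
  also have "\<dots> = (\<Sum>a'\<in>UNIV. \<Sum>x\<in>UNIV.
      measure (mdp_law P \<mu> p) {\<omega>. \<omega> t = x} * pmf (P (fst x) (snd x)) s' * p $ s' $ a')"
  proof (rule sum.cong[OF refl])
    fix a'
    show "measure (mdp_law P \<mu> p) {\<omega>. \<omega> (Suc t) = (s', a')} = (\<Sum>x\<in>UNIV.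
        measure (mdp_law P \<mu> p) {\<omega>. \<omega> t = x} * pmf (P (fst x) (snd x)) s' * p $ s' $ a')"
      using measure_mdp_law_sum[OF measurable_coord[of t P \<mu> p]
          measurable_coord_fun[of "\<lambda>x. x = (s', a')" "Suc t"]] p
      by (simp add: measure_mdp_law_markov pmf_mdp_step mult.assoc)
  qed
  also have "\<dots> = (\<Sum>x\<in>UNIV. measure (mdp_law P \<mu> p) {\<omega>. \<omega> t = x} * pmf (P (fst x) (snd x)) s')"
    by (subst sum.swap) (simp add: sum1 flip: sum_distrib_left)
  also have "\<dots> = (\<Sum>s\<in>UNIV. \<Sum>a\<in>UNIV. measure (mdp_law P \<mu> p) {\<omega>. \<omega> t = (s, a)} * pmf (P s a) s')"
    by (simp add: sum_UNIV_prod)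
  finally show ?thesis by (simp add: pair_prob_eq[OF p])
qed

lemma state_prob_le_1: "state_prob P \<mu> p t s \<le> 1"
  unfolding state_prob_def by (rule prob_space.prob_le_1[OF prob_space_mdp_law])

lemma summable_discounted_state_prob:
  assumes "0 \<le> \<gamma>" "\<gamma> < 1"
  shows "summable (\<lambda>t. \<gamma> ^ t * state_prob P \<mu> p t s)"
  using assms
  by (intro summable_comparison_test[OF _ summable_geometric[of \<gamma>]])
     (auto intro!: mult_left_le state_prob_le_1)

lemma state_dist_eq_suminf:
  "state_dist P \<gamma> \<mu> p s = (1 - \<gamma>) * (\<Sum>t. \<gamma> ^ t * state_prob P \<mu> p t s)"
  by (simp add: state_dist_def state_prob_def)

lemma state_dist_nonneg:
  assumes "0 \<le> \<gamma>" "\<gamma> < 1"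
  shows "0 \<le> state_dist P \<gamma> \<mu> p s"
  unfolding state_dist_eq_suminf using assms
  by (intro mult_nonneg_nonneg suminf_nonneg summable_discounted_state_prob) auto

text \<open>
  The occupancy measure is the discounted sum of the state marginals; separating the initial term and
  pushing the others back by one step through the kernel gives its flow balance. Together with the
  linear formula for the reward below, this is everything that is used about the trajectory law.
\<close>

lemma state_dist_balance:
  assumes "0 \<le> \<gamma>" "\<gamma> < 1" and p: "p \<in> policies"
  shows "state_dist P \<gamma> \<mu> p s' = (1 - \<gamma>) * pmf \<mu> s' +
    \<gamma> * (\<Sum>s\<in>UNIV. \<Sum>a\<in>UNIV. state_dist P \<gamma> \<mu> p s * p $ s $ a * pmf (P s a) s')"
proof -
  note sm = summable_discounted_state_prob[OF assms(1,2), of P \<mu> p]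
  have head: "(\<Sum>t. \<gamma> ^ t * state_prob P \<mu> p t s') =
      pmf \<mu> s' + (\<Sum>t. \<gamma> ^ Suc t * state_prob P \<mu> p (Suc t) s')"
    using suminf_split_head[OF sm[of s']] by (simp add: state_prob_0[OF p])
  have "(\<lambda>t. \<gamma> ^ Suc t * state_prob P \<mu> p (Suc t) s') sums (\<gamma> *
      (\<Sum>s\<in>UNIV. \<Sum>a\<in>UNIV. (\<Sum>t. \<gamma> ^ t * state_prob P \<mu> p t s) * (p $ s $ a * pmf (P s a) s')))"
  proof -
    have "(\<lambda>t. \<gamma> * (\<Sum>s\<in>UNIV. \<Sum>a\<in>UNIV. \<gamma> ^ t * state_prob P \<mu> p t s * (p $ s $ a * pmf (P s a) s')))
        sums (\<gamma> * (\<Sum>s\<in>UNIV. \<Sum>a\<in>UNIV. (\<Sum>t. \<gamma> ^ t * state_prob P \<mu> p t s) * (p $ s $ a * pmf (P s a) s')))"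
      by (intro sums_mult sums_sum sums_mult2 summable_sums sm)
    then show ?thesis
      by (simp add: state_prob_Suc[OF p] sum_distrib_left mult_ac)
  qed
  then have tail: "(\<Sum>t. \<gamma> ^ Suc t * state_prob P \<mu> p (Suc t) s') = \<gamma> *
      (\<Sum>s\<in>UNIV. \<Sum>a\<in>UNIV. (\<Sum>t. \<gamma> ^ t * state_prob P \<mu> p t s) * (p $ s $ a * pmf (P s a) s'))"
    by (rule sums_unique[symmetric])
  show ?thesis
    unfolding state_dist_eq_suminf head tail
    by (simp only: distrib_left sum_distrib_left mult_ac)
qed

text \<open>
  Rewards are bounded, so the discounted series is dominated by a geometric one and may be integrated
  term by term; each term is an expectation of a function of a single state-action pair.
\<close>

lemma reward_eq_sum_state_dist:
  fixes p :: "real ^ 'a::finite ^ 's::finite"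
  assumes "0 \<le> \<gamma>" "\<gamma> < 1" and p: "p \<in> policies"
  shows "reward P r \<gamma> \<mu> p = (\<Sum>s\<in>UNIV. \<Sum>a\<in>UNIV. state_dist P \<gamma> \<mu> p s * p $ s $ a * r s a)"
proof -
  interpret prob_space "mdp_law P \<mu> p" by (rule prob_space_mdp_law)
  let ?M = "mdp_law P \<mu> p" and ?f = "\<lambda>t \<omega>. \<gamma> ^ t * r (fst (\<omega> t)) (snd (\<omega> t))"
  define B where "B = Max (range (\<lambda>(s, a). \<bar>r s a\<bar>))"
  have B: "\<bar>r s a\<bar> \<le> B" for s a
    unfolding B_def by (intro Max_ge) auto
  have meas [measurable]: "?f t \<in> borel_measurable ?M" for t
    using measurable_coord_fun[of "\<lambda>x. \<gamma> ^ t * r (fst x) (snd x)" t P \<mu> p]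
    by (rule measurable_compose) simp
  have bd: "\<bar>?f t \<omega>\<bar> \<le> B * \<gamma> ^ t" for t \<omega>
    using B[of "fst (\<omega> t)" "snd (\<omega> t)"] assms(1) by (simp add: abs_mult mult.commute[of B] mult_left_mono)
  have int: "integrable ?M (?f t)" for t
    using bd by (intro integrable_const_bound[of _ "B * \<gamma> ^ t"]) auto
  have geo: "summable (\<lambda>t. B * \<gamma> ^ t)"
    using assms by (intro summable_mult summable_geometric) auto
  have sm: "summable (\<lambda>t. norm (?f t \<omega>))" for \<omega>
    by (rule summable_comparison_test[OF _ geo]) (use bd in auto)
  have "norm (LINT \<omega>|?M. norm (?f t \<omega>)) \<le> B * \<gamma> ^ t" for t
  proof -
    have "(LINT \<omega>|?M. norm (?f t \<omega>)) \<le> (LINT \<omega>|?M. B * \<gamma> ^ t)"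
      using bd int[of t] by (intro integral_mono) auto
    then show ?thesis by (simp add: prob_space[simplified])
  qed
  then have smi: "summable (\<lambda>t. LINT \<omega>|?M. norm (?f t \<omega>))"
    by (intro summable_comparison_test[OF _ geo]) auto
  have expect: "(LINT \<omega>|?M. ?f t \<omega>) =
      (\<Sum>s\<in>UNIV. \<Sum>a\<in>UNIV. \<gamma> ^ t * state_prob P \<mu> p t s * (p $ s $ a * r s a))" for t
  proof -
    have ev: "{\<omega>. \<omega> t = x} \<in> sets ?M" for x
      using measurable_coord_fun[of "\<lambda>y. y = x" t P \<mu> p] by (simp add: pred_def)
    have split: "?f t \<omega> = (\<Sum>x\<in>UNIV. \<gamma> ^ t * r (fst x) (snd x) * indicator {\<omega>. \<omega> t = x} \<omega>)" for \<omega>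
    proof -
      have "(\<Sum>x\<in>UNIV. \<gamma> ^ t * r (fst x) (snd x) * indicator {\<omega>. \<omega> t = x} \<omega>) =
          (\<Sum>x\<in>{\<omega> t}. \<gamma> ^ t * r (fst x) (snd x) * indicator {\<omega>. \<omega> t = x} \<omega>)"
        by (rule sum.mono_neutral_right) (auto simp: indicator_def)
      then show ?thesis by simp
    qed
    have "(LINT \<omega>|?M. ?f t \<omega>) =
        (LINT \<omega>|?M. (\<Sum>x\<in>UNIV. \<gamma> ^ t * r (fst x) (snd x) * indicator {\<omega>. \<omega> t = x} \<omega>))"
      by (rule Bochner_Integration.integral_cong[OF refl split])
    also have "\<dots> = (\<Sum>x\<in>UNIV. \<gamma> ^ t * r (fst x) (snd x) * measure ?M {\<omega>. \<omega> t = x})"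
      using ev by (subst Bochner_Integration.integral_sum)
        (simp_all add: integrable_real_mult_indicator less_top[symmetric])
    also have "\<dots> = (\<Sum>s\<in>UNIV. \<Sum>a\<in>UNIV. \<gamma> ^ t * r s a * measure ?M {\<omega>. \<omega> t = (s, a)})"
      by (simp add: sum_UNIV_prod)
    finally show ?thesis by (simp add: pair_prob_eq[OF p] mult_ac)
  qed
  note smp = summable_discounted_state_prob[OF assms(1,2), of P \<mu> p]
  have "(LINT \<omega>|?M. (\<Sum>t. ?f t \<omega>)) = (\<Sum>t. LINT \<omega>|?M. ?f t \<omega>)"
    by (rule integral_suminf[OF int AE_I2[OF sm] smi])
  also have "\<dots> = (\<Sum>s\<in>UNIV. \<Sum>a\<in>UNIV. (\<Sum>t. \<gamma> ^ t * state_prob P \<mu> p t s) * (p $ s $ a * r s a))"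
    unfolding expect
    by (intro sums_unique[symmetric] sums_sum sums_mult2 summable_sums smp)
  finally show ?thesis
    unfolding reward_def state_dist_eq_suminf by (simp only: sum_distrib_left mult_ac)
qed

section \<open>Sup-norm contractions on finite state spaces\<close>

text \<open>
  A self-bounding estimate: apply the hypothesis to the largest value of \<open>\<bar>x s\<bar>\<close> and solve for it.
\<close>

lemma sup_contraction_bound:
  fixes x :: "'s::finite \<Rightarrow> real"
  assumes \<gamma>: "\<gamma> < 1"
    and le: "\<And>c. (\<And>s. \<bar>x s\<bar> \<le> c) \<Longrightarrow> (\<And>s. \<bar>x s\<bar> \<le> e + \<gamma> * c)"
  shows "\<bar>x s\<bar> \<le> e / (1 - \<gamma>)"
proof -
  \<comment> \<open>The hypothesis only helps for a bound that is attained.\<close>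
  define c where "c = Max (range (\<lambda>s. \<bar>x s\<bar>))"
  have c: "\<bar>x s\<bar> \<le> c" for s unfolding c_def by (intro Max_ge) auto
  have "c \<in> range (\<lambda>s. \<bar>x s\<bar>)" unfolding c_def by (intro Max_in) auto
  then obtain s0 where "c = \<bar>x s0\<bar>" by blast
  with le[OF c, of s0] have "c \<le> e + \<gamma> * c" by simp
  then have "c \<le> e / (1 - \<gamma>)" using \<gamma> by (simp add: field_simps)
  with c[of s] show ?thesis by simp
qed

text \<open>
  On finitely many coordinates, existence follows from Brouwer's theorem on the cube
  \<open>\<bar>x $ s\<bar> \<le> B\<close>: the contraction property makes the map continuous, and \<open>B\<close> is chosen so that the cube is mapped into itself. Uniqueness is the
  self-bounding estimate for the difference of two fixed points.
\<close>

lemma sup_contraction_ex1_fixpoint: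
  fixes F :: "('s::finite \<Rightarrow> real) \<Rightarrow> 's \<Rightarrow> real"
  assumes \<gamma>: "0 \<le> \<gamma>" "\<gamma> < 1"
    and contr: "\<And>u v c s. (\<And>s. \<bar>u s - v s\<bar> \<le> c) \<Longrightarrow> \<bar>F u s - F v s\<bar> \<le> \<gamma> * c"
  shows "\<exists>!u. \<forall>s. u s = F u s"
proof (rule ex_ex1I)
  \<comment> \<open>The smallest radius with \<open>\<bar>F 0\<bar> + \<gamma> * B \<le> B\<close>.\<close>
  define B where "B = Max (range (\<lambda>s. \<bar>F (\<lambda>_. 0) s\<bar>)) / (1 - \<gamma>)"
  have B1: "\<bar>F (\<lambda>_. 0) s\<bar> \<le> (1 - \<gamma>) * B" for s
    using \<gamma> unfolding B_def by (simp add: Max_ge)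
  have B0: "0 \<le> (1 - \<gamma>) * B" using B1 abs_ge_zero order_trans by blast
  define G :: "real ^ 's \<Rightarrow> real ^ 's" where "G x = (\<chi> s. F (vec_nth x) s)" for x
  have dist: "\<bar>G x $ s - G y $ s\<bar> \<le> \<gamma> * norm (x - y)" for x y s
    unfolding G_def using component_le_norm_cart[of "x - y"] by (auto intro!: contr)
  have cont: "continuous_on S G" for S
  proof -
    have "continuous_on S (\<lambda>x. G x $ s)" for s
    proof (rule continuous_on_iff[THEN iffD2], intro ballI allI impI)
      fix x and e :: real assume "0 < e"
      moreover have "\<bar>G y $ s - G x $ s\<bar> \<le> norm (y - x)" for y
        using dist[of y s x] \<gamma> mult_right_mono[of \<gamma> 1 "norm (y - x)"] by simp
      ultimately show "\<exists>d>0. \<forall>x'\<in>S. dist x' x < d \<longrightarrow> dist (G x' $ s) (G x $ s) < e"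
        by (intro exI[of _ e]) (auto simp: dist_norm intro: le_less_trans)
    qed
    then have "continuous_on S (\<lambda>x. \<chi> s. G x $ s)" by (rule continuous_on_vec_lambda)
    then show ?thesis by (simp only: vec_nth_inverse)
  qed
  let ?K = "{x :: real ^ 's. \<forall>s. \<bar>x $ s\<bar> \<le> B}"
  have K: "?K = cbox (\<chi> s. - B) (\<chi> s. B)"
    by (auto simp: mem_box_cart abs_le_iff) (metis minus_le_iff)+
  have self: "G \<in> ?K \<rightarrow> ?K"
  proof
    fix x assume x: "x \<in> ?K"
    have "\<bar>G x $ s\<bar> \<le> B" for s
    proof -
      have "\<bar>F (vec_nth x) s - F (\<lambda>_. 0) s\<bar> \<le> \<gamma> * B" using x by (intro contr) auto
      with B1[of s] show ?thesis by (simp add: G_def algebra_simps)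
    qed
    then show "G x \<in> ?K" by simp
  qed
  have "0 \<le> B" using B0 \<gamma> by (simp add: zero_le_mult_iff)
  then have ne: "?K \<noteq> {}" by (intro ex_in_conv[THEN iffD1] exI[of _ 0]) simp
  obtain x where "G x = x"
    using brouwer[OF _ _ ne cont self] unfolding K by (metis compact_cbox convex_box(1))
  then have "\<forall>s. F (vec_nth x) s = x $ s" unfolding G_def by (metis vec_lambda_beta)
  then show "\<exists>u. \<forall>s. u s = F u s" by (metis)
next
  fix u v assume uv: "\<forall>s. u s = F u s" "\<forall>s. v s = F v s"
  have "\<bar>u s - v s\<bar> \<le> 0 / (1 - \<gamma>)" for s
  proof (rule sup_contraction_bound[OF \<gamma>(2)])
    fix c s assume "\<And>s. \<bar>u s - v s\<bar> \<le> c"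
    then have "\<bar>F u s - F v s\<bar> \<le> \<gamma> * c" by (rule contr)
    then show "\<bar>u s - v s\<bar> \<le> 0 + \<gamma> * c" using uv by simp
  qed
  then show "u = v" by (auto simp: fun_eq_iff)
qed

lemma abs_convex_comb_le:
  fixes p x :: "'a \<Rightarrow> real"
  assumes "finite A" and p: "\<And>a. a \<in> A \<Longrightarrow> 0 \<le> p a" "sum p A = 1" and x: "\<And>a. a \<in> A \<Longrightarrow> \<bar>x a\<bar> \<le> c"
  shows "\<bar>\<Sum>a\<in>A. p a * x a\<bar> \<le> c"
proof -
  have "\<bar>\<Sum>a\<in>A. p a * x a\<bar> \<le> (\<Sum>a\<in>A. p a * c)"
    using p x by (intro order_trans[OF sum_abs] sum_mono) (simp add: abs_mult mult_left_mono)
  then show ?thesis using p by (simp flip: sum_distrib_right)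
qed

lemma sum_rotate:
  "(\<Sum>x\<in>A. \<Sum>y\<in>B. \<Sum>z\<in>C. f x y z) = (\<Sum>y\<in>B. \<Sum>z\<in>C. \<Sum>x\<in>A. f x y z)"
  by (subst sum.swap) (rule sum.cong[OF refl], rule sum.swap)

section \<open>Values and advantages\<close>

lemma policiesD:
  assumes "p \<in> policies"
  shows "0 \<le> p $ s $ a" "(\<Sum>a\<in>UNIV. p $ s $ a) = 1"
  using assms by (simp_all add: policies_def prob_simplex_def)

lemma sum_pmf_UNIV [simp]: "(\<Sum>s\<in>UNIV. pmf q (s :: 's::finite)) = 1"
  by (rule sum_pmf_eq_1) auto

text \<open>
  The initial distribution is left out of the parameters: values, soft policies and the flow do not
  depend on it, and the convergence proof exploits this by changing it.
\<close>

locale discounted_mdp =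
  fixes P :: "'s::finite \<Rightarrow> 'a::finite \<Rightarrow> 's pmf"
    and r :: "'s \<Rightarrow> 'a \<Rightarrow> real"
    and \<gamma> :: real
  assumes discount: "0 \<le> \<gamma>" "\<gamma> < 1"
begin

text \<open>
  The one-step lookahead, with the reward scaled by \<open>t\<close>. The case \<open>t = 1\<close> is the usual action value
  of \<open>v\<close>; other \<open>t\<close> serve the entropy-regularised problem with inverse temperature \<open>t\<close>. Carrying
  \<open>t\<close> as an argument makes the expression jointly linear in \<open>t\<close> and \<open>v\<close>.
\<close>

definition backup :: "real \<Rightarrow> ('s \<Rightarrow> real) \<Rightarrow> 's \<Rightarrow> 'a \<Rightarrow> real" where
  "backup t v s a = t * r s a + \<gamma> * (\<Sum>s'\<in>UNIV. pmf (P s a) s' * v s')"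

lemma backup_diff: "backup t u s a - backup t' v s a = backup (t - t') (\<lambda>s. u s - v s) s a"
  by (simp add: backup_def algebra_simps sum_subtractf)

lemma backup_cmult: "backup (c * t) (\<lambda>s. c * v s) s a = c * backup t v s a"
  by (simp add: backup_def algebra_simps sum_distrib_left)

lemma abs_backup_le:
  assumes "\<And>s a. \<bar>r s a\<bar> \<le> \<rho>" "\<And>s. \<bar>v s\<bar> \<le> c"
  shows "\<bar>backup t v s a\<bar> \<le> \<bar>t\<bar> * \<rho> + \<gamma> * c"
proof -
  have "\<bar>backup t v s a\<bar> \<le> \<bar>t * r s a\<bar> + \<bar>\<gamma> * (\<Sum>s'\<in>UNIV. pmf (P s a) s' * v s')\<bar>"
    unfolding backup_def by (rule abs_triangle_ineq)
  also have "\<dots> \<le> \<bar>t\<bar> * \<rho> + \<gamma> * c"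
    unfolding abs_mult using assms discount abs_convex_comb_le[of UNIV "pmf (P s a)" v c]
    by (intro add_mono mult_mono) (auto simp: mult_left_mono)
  finally show ?thesis .
qed

lemma abs_backup_0_le:
  assumes "\<And>s. \<bar>v s\<bar> \<le> c"
  shows "\<bar>backup 0 v s a\<bar> \<le> \<gamma> * c"
  using abs_convex_comb_le[of UNIV "pmf (P s a)" v c] assms discount
  by (simp add: backup_def abs_mult mult_left_mono)

definition policy_value :: "real ^ 'a ^ 's \<Rightarrow> 's \<Rightarrow> real" where
  "policy_value p = (THE v. \<forall>s. v s = (\<Sum>a\<in>UNIV. p $ s $ a * backup 1 v s a))"

lemma policy_value_ex1:
  assumes p: "p \<in> policies"
  shows "\<exists>!v. \<forall>s. v s = (\<Sum>a\<in>UNIV. p $ s $ a * backup 1 v s a)"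
proof (rule sup_contraction_ex1_fixpoint[OF discount])
  fix u v :: "'s \<Rightarrow> real" and c s assume *: "\<And>s. \<bar>u s - v s\<bar> \<le> c"
  have "\<bar>\<Sum>a\<in>UNIV. p $ s $ a * backup 0 (\<lambda>s. u s - v s) s a\<bar> \<le> \<gamma> * c"
    using policiesD[OF p] by (intro abs_convex_comb_le abs_backup_0_le *) auto
  then show "\<bar>(\<Sum>a\<in>UNIV. p $ s $ a * backup 1 u s a) - (\<Sum>a\<in>UNIV. p $ s $ a * backup 1 v s a)\<bar> \<le> \<gamma> * c"
    by (simp flip: backup_diff[of 1 _ _ _ 1, simplified] add: algebra_simps sum_subtractf)
qed

lemma policy_value_bellman:
  assumes "p \<in> policies"
  shows "policy_value p s = (\<Sum>a\<in>UNIV. p $ s $ a * backup 1 (policy_value p) s a)"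
  using theI'[OF policy_value_ex1[OF assms]] unfolding policy_value_def by blast

text \<open>
  Values are not multiplied by \<open>1 - \<gamma>\<close>, unlike the reward; the normalisation is absorbed by the
  occupancy measure, which has total mass 1.
\<close>

definition advantage :: "real ^ 'a ^ 's \<Rightarrow> 's \<Rightarrow> 'a \<Rightarrow> real" where
  "advantage p s a = backup 1 (policy_value p) s a - policy_value p s"

lemma sum_advantage:
  assumes "p \<in> policies"
  shows "(\<Sum>a\<in>UNIV. p $ s $ a * advantage p s a) = 0"
  using policy_value_bellman[OF assms, of s] policiesD[OF assms]
  by (simp add: advantage_def right_diff_distrib sum_subtractf flip: sum_distrib_right)

abbreviation occupancy :: "'s pmf \<Rightarrow> real ^ 'a ^ 's \<Rightarrow> 's \<Rightarrow> real" where
  "occupancy \<mu> p \<equiv> state_dist P \<gamma> \<mu> p"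

abbreviation R :: "'s pmf \<Rightarrow> real ^ 'a ^ 's \<Rightarrow> real" where
  "R \<mu> p \<equiv> reward P r \<gamma> \<mu> p"

abbreviation DK :: "'s pmf \<Rightarrow> real ^ 'a ^ 's \<Rightarrow> real ^ 'a ^ 's \<Rightarrow> real" where
  "DK \<mu> p q \<equiv> kakade_div P \<gamma> \<mu> p q"

text \<open>
  Potential shaping: testing the flow balance of the occupancy measure against an arbitrary function
  \<open>u\<close> trades the initial expectation of \<open>u\<close> for an expectation of \<open>backup t u - u\<close> along the
  trajectory. With \<open>u\<close> a policy value it is the performance difference lemma, with \<open>u\<close> a soft value
  it linearises the regularised objective.
\<close>

lemma reward_eq_potential:
  assumes p: "p \<in> policies"
  shows "t * R \<mu> p = (1 - \<gamma>) * (\<Sum>s\<in>UNIV. pmf \<mu> s * u s) +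
    (\<Sum>s\<in>UNIV. occupancy \<mu> p s * (\<Sum>a\<in>UNIV. p $ s $ a * (backup t u s a - u s)))"
proof -
  let ?d = "occupancy \<mu> p"
  have "(\<Sum>s'\<in>UNIV. ?d s' * u s') = (\<Sum>s'\<in>UNIV. (1 - \<gamma>) * (pmf \<mu> s' * u s') +
      \<gamma> * (\<Sum>s\<in>UNIV. \<Sum>a\<in>UNIV. ?d s * p $ s $ a * (pmf (P s a) s' * u s')))"
    by (subst state_dist_balance[OF discount p])
      (simp add: sum_distrib_right sum_distrib_left algebra_simps)
  also have "\<dots> = (1 - \<gamma>) * (\<Sum>s\<in>UNIV. pmf \<mu> s * u s) +
      \<gamma> * (\<Sum>s'\<in>UNIV. \<Sum>s\<in>UNIV. \<Sum>a\<in>UNIV. ?d s * p $ s $ a * (pmf (P s a) s' * u s'))"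
    by (simp add: sum.distrib sum_distrib_left)
  also have "(\<Sum>s'\<in>UNIV. \<Sum>s\<in>UNIV. \<Sum>a\<in>UNIV. ?d s * p $ s $ a * (pmf (P s a) s' * u s')) =
      (\<Sum>s\<in>UNIV. \<Sum>a\<in>UNIV. ?d s * p $ s $ a * (\<Sum>s'\<in>UNIV. pmf (P s a) s' * u s'))"
    unfolding sum_distrib_left by (rule sum_rotate)
  finally have bal: "(\<Sum>s\<in>UNIV. ?d s * u s) = (1 - \<gamma>) * (\<Sum>s\<in>UNIV. pmf \<mu> s * u s) +
      \<gamma> * (\<Sum>s\<in>UNIV. \<Sum>a\<in>UNIV. ?d s * p $ s $ a * (\<Sum>s'\<in>UNIV. pmf (P s a) s' * u s'))" .
  have "(\<Sum>s\<in>UNIV. ?d s * (\<Sum>a\<in>UNIV. p $ s $ a * (backup t u s a - u s))) =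
      (\<Sum>s\<in>UNIV. ?d s * ((\<Sum>a\<in>UNIV. p $ s $ a * backup t u s a) - u s))"
    using policiesD[OF p]
    by (simp add: right_diff_distrib sum_subtractf flip: sum_distrib_right)
  also have "\<dots> = t * R \<mu> p + \<gamma> * (\<Sum>s\<in>UNIV. \<Sum>a\<in>UNIV. ?d s * p $ s $ a * (\<Sum>s'\<in>UNIV. pmf (P s a) s' * u s'))
      - (\<Sum>s\<in>UNIV. ?d s * u s)"
    unfolding reward_eq_sum_state_dist[OF discount p] backup_def
    by (simp only: right_diff_distrib distrib_left sum_subtractf sum.distrib sum_distrib_left mult_ac)
  finally show ?thesis using bal by simp
qed

lemma reward_eq_policy_value:
  assumes p: "p \<in> policies"
  shows "R \<mu> p = (1 - \<gamma>) * (\<Sum>s\<in>UNIV. pmf \<mu> s * policy_value p s)"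
  using reward_eq_potential[OF p, of 1 \<mu> "policy_value p"] sum_advantage[OF p]
  by (simp add: advantage_def)

text \<open>
  Starting in \<open>s\<close>, the reward is the value at \<open>s\<close>. This transports continuity in the policy from the
  reward to the value.
\<close>

lemma policy_value_eq_reward:
  assumes p: "p \<in> policies"
  shows "policy_value p s = R (return_pmf s) p / (1 - \<gamma>)"
proof -
  have "(\<Sum>s'\<in>UNIV. pmf (return_pmf s) s' * policy_value p s') = policy_value p s"
    by (subst sum.mono_neutral_right[of UNIV "{s}"]) (auto simp: pmf_return)
  then show ?thesis using reward_eq_policy_value[OF p, of "return_pmf s"] discount by simp
qed

lemma performance_difference:
  assumes p: "p \<in> policies" and q: "q \<in> policies"
  shows "R \<mu> q - R \<mu> p = (\<Sum>s\<in>UNIV. occupancy \<mu> q s * (\<Sum>a\<in>UNIV. q $ s $ a * advantage p s a))"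
  using reward_eq_potential[OF q, of 1 \<mu> "policy_value p"] reward_eq_policy_value[OF p, of \<mu>]
  by (simp add: advantage_def)

text \<open>
  Both occupancy measures solve the balance equation. The difference of the two right-hand sides splits
  into a term that contracts the \<open>l1\<close> distance by \<open>\<gamma>\<close> and a term that sees the policies only where
  \<open>q\<close> goes. The weight \<open>occupancy \<mu> q s\<close> on the right matters: it also yields that policies agreeing
  on the states visited by one of them have the same occupancy.
\<close>

lemma occupancy_diff_le:
  assumes p: "p \<in> policies" and q: "q \<in> policies"
  shows "(\<Sum>s\<in>UNIV. \<bar>occupancy \<mu> p s - occupancy \<mu> q s\<bar>) \<le>
    \<gamma> / (1 - \<gamma>) * (\<Sum>s\<in>UNIV. \<Sum>a\<in>UNIV. occupancy \<mu> q s * \<bar>p $ s $ a - q $ s $ a\<bar>)"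
proof -
  let ?d = "occupancy \<mu> p" and ?e = "occupancy \<mu> q"
  \<comment> \<open>Bounds \<open>\<bar>d * p - e * q\<bar>\<close> after inserting \<open>e * p\<close>.\<close>
  let ?m = "\<lambda>s a. \<bar>?d s - ?e s\<bar> * p $ s $ a + ?e s * \<bar>p $ s $ a - q $ s $ a\<bar>"
  have "\<bar>?d s' - ?e s'\<bar> \<le> \<gamma> * (\<Sum>s\<in>UNIV. \<Sum>a\<in>UNIV. ?m s a * pmf (P s a) s')" for s'
  proof -
    have "?d s' - ?e s' = \<gamma> * (\<Sum>s\<in>UNIV. \<Sum>a\<in>UNIV. (?d s * p $ s $ a - ?e s * q $ s $ a) * pmf (P s a) s')"
      by (subst (1 2) state_dist_balance[OF discount])
         (use p q in \<open>simp_all add: left_diff_distrib sum_subtractf right_diff_distrib\<close>)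
    also have "\<bar>\<dots>\<bar> \<le> \<gamma> * (\<Sum>s\<in>UNIV. \<Sum>a\<in>UNIV. ?m s a * pmf (P s a) s')"
    proof -
      have m: "\<bar>?d s * p $ s $ a - ?e s * q $ s $ a\<bar> \<le> ?m s a" for s a
      proof -
        have "?d s * p $ s $ a - ?e s * q $ s $ a = (?d s - ?e s) * p $ s $ a + ?e s * (p $ s $ a - q $ s $ a)"
          by (simp add: algebra_simps)
        also have "\<bar>\<dots>\<bar> \<le> \<bar>(?d s - ?e s) * p $ s $ a\<bar> + \<bar>?e s * (p $ s $ a - q $ s $ a)\<bar>"
          by (rule abs_triangle_ineq)
        also have "\<dots> = ?m s a"
          using policiesD(1)[OF p] state_dist_nonneg[OF discount, of P \<mu> q] by (simp add: abs_mult)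
        finally show ?thesis .
      qed
      have "\<bar>\<Sum>s\<in>UNIV. \<Sum>a\<in>UNIV. (?d s * p $ s $ a - ?e s * q $ s $ a) * pmf (P s a) s'\<bar>
          \<le> (\<Sum>s\<in>UNIV. \<Sum>a\<in>UNIV. ?m s a * pmf (P s a) s')"
        by (intro order_trans[OF sum_abs] sum_mono) (auto simp: abs_mult intro!: mult_right_mono m)
      then show ?thesis using discount by (simp add: abs_mult mult_left_mono)
    qed
    finally show ?thesis .
  qed
  then have "(\<Sum>s'\<in>UNIV. \<bar>?d s' - ?e s'\<bar>) \<le> (\<Sum>s'\<in>UNIV. \<gamma> * (\<Sum>s\<in>UNIV. \<Sum>a\<in>UNIV. ?m s a * pmf (P s a) s'))"
    by (rule sum_mono)
  also have "\<dots> = \<gamma> * (\<Sum>s\<in>UNIV. \<Sum>a\<in>UNIV. \<Sum>s'\<in>UNIV. ?m s a * pmf (P s a) s')"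
    by (simp only: sum_distrib_left[symmetric] sum_rotate)
  also have "\<dots> = \<gamma> * ((\<Sum>s\<in>UNIV. \<bar>?d s - ?e s\<bar>) + (\<Sum>s\<in>UNIV. \<Sum>a\<in>UNIV. ?e s * \<bar>p $ s $ a - q $ s $ a\<bar>))"
    using policiesD(2)[OF p]
    by (simp add: sum.distrib flip: sum_distrib_left)
  finally show ?thesis using discount by (simp add: field_simps)
qed

lemma occupancy_cong:
  assumes p: "p \<in> policies" and q: "q \<in> policies"
    and eq: "\<And>s. 0 < occupancy \<mu> q s \<Longrightarrow> p $ s = q $ s"
  shows "occupancy \<mu> p = occupancy \<mu> q"
proof -
  have "occupancy \<mu> q s * \<bar>p $ s $ a - q $ s $ a\<bar> = 0" for s a
    using eq[of s] state_dist_nonneg[OF discount, of P \<mu> q s] by force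
  then have "(\<Sum>s\<in>UNIV. \<Sum>a\<in>UNIV. occupancy \<mu> q s * \<bar>p $ s $ a - q $ s $ a\<bar>) = 0"
    by (intro sum.neutral ballI)
  then have "(\<Sum>s\<in>UNIV. \<bar>occupancy \<mu> p s - occupancy \<mu> q s\<bar>) \<le> 0"
    using occupancy_diff_le[OF p q, of \<mu>] by simp
  then have "(\<Sum>s\<in>UNIV. \<bar>occupancy \<mu> p s - occupancy \<mu> q s\<bar>) = 0"
    by (intro antisym sum_nonneg) auto
  then show ?thesis by (auto simp: sum_nonneg_eq_0_iff fun_eq_iff)
qed

lemma continuous_on_occupancy: "continuous_on policies (\<lambda>p. occupancy \<mu> p s)"
  unfolding continuous_on_def
proof
  fix q :: "real ^ 'a ^ 's" assume q: "q \<in> policies"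
  let ?b = "\<lambda>p. \<gamma> / (1 - \<gamma>) * (\<Sum>s\<in>UNIV. \<Sum>a\<in>UNIV. occupancy \<mu> q s * \<bar>p $ s $ a - q $ s $ a\<bar>)"
  have "(?b \<longlongrightarrow> ?b q) (at q within policies)"
    by (intro tendsto_intros)
  then have b: "(?b \<longlongrightarrow> 0) (at q within policies)" by simp
  have "\<forall>\<^sub>F p in at q within policies. dist (occupancy \<mu> p s) (occupancy \<mu> q s) \<le> ?b p"
    unfolding eventually_at_filter
  proof (intro always_eventually allI impI)
    fix p :: "real ^ 'a ^ 's" assume "p \<in> policies"
    then show "dist (occupancy \<mu> p s) (occupancy \<mu> q s) \<le> ?b p"
      unfolding dist_real_def
      by (intro order_trans[OF member_le_sum[of s UNIV "\<lambda>s. \<bar>occupancy \<mu> p s - occupancy \<mu> q s\<bar>"]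
            occupancy_diff_le[OF _ q]]) auto
  qed
  then show "((\<lambda>p. occupancy \<mu> p s) \<longlongrightarrow> occupancy \<mu> q s) (at q within policies)"
    by (rule metric_tendsto_imp_tendsto[OF b eventually_mono])
      (erule order_trans, simp only: dist_real_def diff_0_right abs_ge_self)
qed

lemma continuous_on_reward: "continuous_on policies (R \<mu>)"
proof -
  have "continuous_on policies (\<lambda>p. \<Sum>s\<in>UNIV. \<Sum>a\<in>UNIV. occupancy \<mu> p s * p $ s $ a * r s a)"
    by (intro continuous_intros continuous_on_occupancy)
  then show ?thesis by (simp add: reward_eq_sum_state_dist[OF discount] cong: continuous_on_cong)
qed

lemma continuous_on_policy_value: "continuous_on policies (\<lambda>p. policy_value p s)"
proof -
  have "continuous_on policies (\<lambda>p. R (return_pmf s) p / (1 - \<gamma>))"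
    using discount by (intro continuous_intros continuous_on_reward) auto
  then show ?thesis by (simp add: policy_value_eq_reward cong: continuous_on_cong)
qed

lemma compact_policies: "compact (policies :: (real ^ 'a ^ 's) set)"
proof -
  have "closed (policies :: (real ^ 'a ^ 's) set)"
    unfolding policies_def prob_simplex_def mem_Collect_eq
    by (intro closed_Collect_all closed_Collect_conj closed_Collect_le closed_Collect_eq continuous_intros)
  moreover have "bounded (policies :: (real ^ 'a ^ 's) set)"
  proof (rule boundedI)
    fix p :: "real ^ 'a ^ 's" assume p: "p \<in> policies"
    have "norm p \<le> (\<Sum>s\<in>UNIV. norm (p $ s))" unfolding norm_vec_def[of p] by (rule L2_set_le_sum) simp
    also have "\<dots> \<le> (\<Sum>s\<in>(UNIV :: 's set). 1)"
    proof (rule sum_mono)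
      fix s
      have "norm (p $ s) \<le> (\<Sum>a\<in>UNIV. \<bar>p $ s $ a\<bar>)" by (rule norm_le_l1_cart)
      then show "norm (p $ s) \<le> 1" using policiesD[OF p] by simp
    qed
    finally show "norm p \<le> real CARD('s)" by simp
  qed
  ultimately show ?thesis by (simp add: compact_eq_bounded_closed)
qed

end

section \<open>Kullback--Leibler divergence\<close>

text \<open>
  Bounding the divergence from below by the squared Hellinger distance needs only
  \<open>ln u \<le> u - 1\<close> at \<open>u = sqrt (q / p)\<close>. It is a weak form of Pinsker's inequality, and it gives at
  once nonnegativity, the equality case, and convergence of distributions whose divergence vanishes.
\<close>

lemma KL_div_ge_hellinger:
  assumes p: "p \<in> prob_simplex" and q: "q \<in> prob_simplex" and pos: "\<And>x. 0 < q $ x"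
  shows "(\<Sum>x\<in>UNIV. (sqrt (p $ x) - sqrt (q $ x))\<^sup>2) \<le> KL_div p q"
proof -
  have p0: "0 \<le> p $ x" for x using p by (simp add: prob_simplex_def)
  have "2 * p $ x - 2 * (sqrt (p $ x) * sqrt (q $ x)) \<le> p $ x * ln (p $ x / q $ x)" for x
  proof (cases "p $ x = 0")
    case False
    then have px: "0 < p $ x" using p0[of x] by simp
    let ?u = "sqrt (q $ x / p $ x)"
    have "ln ?u \<le> ?u - 1" using px pos by (intro ln_le_minus_one) simp
    moreover have "ln ?u = - ln (p $ x / q $ x) / 2"
      using px pos[of x] by (simp add: ln_sqrt ln_div)
    ultimately have "2 - 2 * ?u \<le> ln (p $ x / q $ x)" by simp
    then have "p $ x * (2 - 2 * ?u) \<le> p $ x * ln (p $ x / q $ x)"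
      using px by (intro mult_left_mono) auto
    moreover have "p $ x * ?u = sqrt (p $ x) * sqrt (q $ x)"
      using px by (simp add: real_sqrt_divide field_simps)
    ultimately show ?thesis by (simp add: algebra_simps)
  qed simp
  then have "(\<Sum>x\<in>UNIV. 2 * p $ x - 2 * (sqrt (p $ x) * sqrt (q $ x))) \<le> KL_div p q"
    unfolding KL_div_def by (rule sum_mono)
  moreover have "(\<Sum>x\<in>UNIV. (sqrt (p $ x) - sqrt (q $ x))\<^sup>2) =
      (\<Sum>x\<in>UNIV. p $ x) + (\<Sum>x\<in>UNIV. q $ x) - (\<Sum>x\<in>UNIV. 2 * (sqrt (p $ x) * sqrt (q $ x)))"
    using p0 pos by (simp add: power2_diff sum_subtractf sum.distrib less_imp_le mult_ac)
  ultimately show ?thesis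
    using p q by (simp add: prob_simplex_def sum_subtractf flip: sum_distrib_left)
qed

lemma KL_div_nonneg:
  assumes "p \<in> prob_simplex" "q \<in> prob_simplex" "\<And>x. 0 < q $ x"
  shows "0 \<le> KL_div p q"
  by (rule order_trans[OF _ KL_div_ge_hellinger[OF assms]]) (simp add: sum_nonneg)

lemma KL_div_tendsto_0_imp_tendsto:
  assumes p: "p \<in> prob_simplex"
    and q: "\<And>i. q i \<in> prob_simplex" "\<And>i x. 0 < q i $ x"
    and lim: "((\<lambda>i. KL_div p (q i)) \<longlongrightarrow> 0) F"
  shows "(q \<longlongrightarrow> p) F"
proof (rule vec_tendstoI)
  fix x
  have p0: "0 \<le> p $ x" using p by (simp add: prob_simplex_def)
  have "(sqrt (p $ x) - sqrt (q i $ x))\<^sup>2 \<le> KL_div p (q i)" for i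
    by (rule order_trans[OF member_le_sum KL_div_ge_hellinger[OF p q]]) auto
  then have "((\<lambda>i. (sqrt (p $ x) - sqrt (q i $ x))\<^sup>2) \<longlongrightarrow> 0) F"
    by (intro tendsto_sandwich[OF _ _ tendsto_const lim]) auto
  then have "((\<lambda>i. sqrt ((sqrt (p $ x) - sqrt (q i $ x))\<^sup>2)) \<longlongrightarrow> sqrt 0) F"
    by (rule tendsto_real_sqrt)
  then have "((\<lambda>i. sqrt (p $ x) - sqrt (q i $ x)) \<longlongrightarrow> 0) F"
    by (simp add: tendsto_rabs_zero_iff)
  then have "((\<lambda>i. (sqrt (p $ x) - (sqrt (p $ x) - sqrt (q i $ x)))\<^sup>2) \<longlongrightarrow> (sqrt (p $ x) - 0)\<^sup>2) F"
    by (intro tendsto_intros)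
  then show "((\<lambda>i. q i $ x) \<longlongrightarrow> p $ x) F"
    using p0 q(2) by (simp add: less_imp_le)
qed

lemma KL_div_eq_0_imp_eq:
  assumes p: "p \<in> prob_simplex" and q: "q \<in> prob_simplex" "\<And>x. 0 < q $ x" and "KL_div p q = 0"
  shows "p = q"
proof -
  have "((\<lambda>_ :: nat. q) \<longlongrightarrow> p) sequentially"
    using assms by (intro KL_div_tendsto_0_imp_tendsto) auto
  then show ?thesis by (simp add: tendsto_const_iff)
qed

text \<open>
  The entropy of \<open>p\<close> cancels, so that the difference is linear in \<open>p\<close>. Zero entries of \<open>p\<close> are
  harmless, since they contribute 0 to every sum.
\<close>

lemma KL_div_diff:
  assumes p: "p \<in> prob_simplex" and q: "\<And>x. 0 < q $ x" "\<And>x. 0 < q' $ x"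
  shows "KL_div p q - KL_div p q' = (\<Sum>x\<in>UNIV. p $ x * ln (q' $ x / q $ x))"
proof -
  have "p $ x * ln (p $ x / q $ x) - p $ x * ln (p $ x / q' $ x) = p $ x * ln (q' $ x / q $ x)" for x
  proof (cases "p $ x = 0")
    case False
    then have "0 < p $ x" using p by (simp add: prob_simplex_def order_less_le)
    then show ?thesis using q[of x] by (simp add: ln_div algebra_simps)
  qed simp
  then show ?thesis by (simp add: KL_div_def flip: sum_subtractf)
qed

lemma continuous_on_x_ln_x_div:
  assumes c: "0 < c"
  shows "continuous_on {0..} (\<lambda>x::real. x * ln (x / c))"
proof -
  have "continuous (at x within {0..}) (\<lambda>x. x * ln (x / c))" if "0 \<le> x" for x
  proof (cases "x = 0")
    case True
    have "((\<lambda>x. x * ln (x / c)) \<longlongrightarrow> 0) (at_right 0)"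
      using c by real_asymp
    then show ?thesis using True by (simp add: continuous_within at_within_Ici_at_right)
  next
    case False
    with that c show ?thesis by (intro continuous_intros) auto
  qed
  then show ?thesis by (simp add: continuous_on_eq_continuous_within)
qed

context discounted_mdp
begin

text \<open>
  The relative interior of the set of policies, in the explicit form that the proofs use.
\<close>

definition positive_policies :: "(real ^ 'a ^ 's) set" where
  "positive_policies = {p \<in> policies. \<forall>s a. 0 < p $ s $ a}"

lemma positive_policiesD: "p \<in> positive_policies \<Longrightarrow> p \<in> policies" "p \<in> positive_policies \<Longrightarrow> 0 < p $ s $ a"
  by (simp_all add: positive_policies_def)

lemma policies_nth: "p \<in> policies \<Longrightarrow> p $ s \<in> prob_simplex"
  by (simp add: policies_def)

lemma DK_nonneg:
  assumes "p \<in> policies" "q \<in> positive_policies"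
  shows "0 \<le> DK \<mu> p q"
  unfolding kakade_div_def using assms
  by (intro sum_nonneg mult_nonneg_nonneg KL_div_nonneg state_dist_nonneg discount)
     (auto simp: policies_nth positive_policiesD)

lemma occupancy_times_KL_le_DK:
  assumes "p \<in> policies" "q \<in> positive_policies"
  shows "occupancy \<mu> p s * KL_div (p $ s) (q $ s) \<le> DK \<mu> p q"
  unfolding kakade_div_def using assms
  by (intro member_le_sum[of s UNIV "\<lambda>s. occupancy \<mu> p s * KL_div (p $ s) (q $ s)"]
      mult_nonneg_nonneg KL_div_nonneg state_dist_nonneg discount)
     (auto simp: policies_nth positive_policiesD)

text \<open>
  The divergence controls the policies only on states that its first argument visits, hence the
  hypothesis on \<open>s\<close>.
\<close>

lemma DK_tendsto_0_imp_tendsto: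
  assumes p: "p \<in> policies" and q: "\<And>i. q i \<in> positive_policies"
    and lim: "((\<lambda>i. DK \<mu> p (q i)) \<longlongrightarrow> 0) F" and d: "0 < occupancy \<mu> p s"
  shows "((\<lambda>i. q i $ s) \<longlongrightarrow> p $ s) F"
proof (rule KL_div_tendsto_0_imp_tendsto)
  show simplex: "p $ s \<in> prob_simplex" "q i $ s \<in> prob_simplex" "0 < q i $ s $ x" for i x
    using p q by (auto simp: policies_nth positive_policiesD)
  have "((\<lambda>i. DK \<mu> p (q i) / occupancy \<mu> p s) \<longlongrightarrow> 0 / occupancy \<mu> p s) F"
    using d by (intro tendsto_intros lim) auto
  then have lim0: "((\<lambda>i. DK \<mu> p (q i) / occupancy \<mu> p s) \<longlongrightarrow> 0) F" by simp
  have le: "KL_div (p $ s) (q i $ s) \<le> DK \<mu> p (q i) / occupancy \<mu> p s" for i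
    using occupancy_times_KL_le_DK[OF p q, of \<mu> s i] d by (simp add: field_simps)
  show "((\<lambda>i. KL_div (p $ s) (q i $ s)) \<longlongrightarrow> 0) F"
    by (rule tendsto_sandwich[OF always_eventually always_eventually tendsto_const lim0])
      (simp_all add: le KL_div_nonneg[OF simplex])
qed

lemma continuous_on_DK:
  assumes q: "q \<in> positive_policies"
  shows "continuous_on policies (\<lambda>p. DK \<mu> p q)"
proof -
  have "continuous_on policies (\<lambda>p. p $ s $ a * ln (p $ s $ a / q $ s $ a))" for s a
  proof (rule continuous_on_compose2[OF continuous_on_x_ln_x_div[OF positive_policiesD(2)[OF q, of s a]]])
    show "continuous_on policies (\<lambda>p. p $ s $ a)" by (intro continuous_intros)
    show "(\<lambda>p. p $ s $ a) ` policies \<subseteq> {0..}" by (auto simp: policiesD)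
  qed
  then have "continuous_on policies (\<lambda>p. KL_div (p $ s) (q $ s))" for s
    unfolding KL_div_def by (rule continuous_on_sum)
  then show ?thesis
    unfolding kakade_div_def
    by (intro continuous_on_sum continuous_on_mult continuous_on_occupancy)
qed

section \<open>The Kakade gradient\<close>

text \<open>
  The Kakade gradient in closed form: it does not involve the initial distribution, because the
  occupancy weights of the metric and of the policy gradient cancel.
\<close>

definition advantage_field :: "real ^ 'a ^ 's \<Rightarrow> real ^ 'a ^ 's" where
  "advantage_field p = (\<chi> s a. p $ s $ a * advantage p s a)"

lemma advantage_field_nth [simp]: "advantage_field p $ s $ a = p $ s $ a * advantage p s a"
  by (simp add: advantage_field_def)

lemma advantage_field_tangent: "p \<in> policies \<Longrightarrow> advantage_field p \<in> policy_tangent"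
  by (simp add: policy_tangent_def sum_advantage)

lemma kakade_metric_advantage_field:
  assumes p: "p \<in> positive_policies"
  shows "kakade_metric P \<gamma> \<mu> p (advantage_field p) w =
    (\<Sum>s\<in>UNIV. occupancy \<mu> p s * (\<Sum>a\<in>UNIV. w $ s $ a * advantage p s a))"
proof -
  have "p $ s $ a \<noteq> 0" for s a using positive_policiesD(2)[OF p, of s a] by simp
  then show ?thesis by (simp add: kakade_metric_def mult_ac)
qed

lemma eventually_policies_along_tangent:
  assumes p: "p \<in> positive_policies" and w: "w \<in> policy_tangent"
  shows "\<forall>\<^sub>F h in nhds 0. p + h *\<^sub>R w \<in> policies"
proof -
  have "((\<lambda>h. p $ s $ a + h * w $ s $ a) \<longlongrightarrow> p $ s $ a + 0 * w $ s $ a) (nhds 0)" for s a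
    by (intro tendsto_intros filterlim_ident)
  then have "\<forall>\<^sub>F h in nhds 0. 0 < p $ s $ a + h * w $ s $ a" for s a
    using positive_policiesD(2)[OF p] by (intro order_tendstoD(1)[where y = "p $ s $ a"]) auto
  then have "\<forall>\<^sub>F h in nhds 0. \<forall>s a. 0 < p $ s $ a + h * w $ s $ a"
    by (intro eventually_all_finite)
  then show ?thesis
  proof eventually_elim
    case (elim h)
    then show ?case
      using p w
      by (simp add: positive_policies_def policies_def prob_simplex_def policy_tangent_def sum.distrib less_imp_le
          flip: sum_distrib_left)
  qed
qed

text \<open>
  The policy gradient theorem. By the performance difference lemma, the difference quotient equals the claimed derivative with the occupancy taken
  at \<open>p + h *\<^sub>R w\<close> instead of \<open>p\<close>, and the occupancy is continuous.
\<close>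

lemma reward_has_derivative_along_tangent:
  assumes p: "p \<in> positive_policies" and w: "w \<in> policy_tangent"
  shows "((\<lambda>h. R \<mu> (p + h *\<^sub>R w)) has_real_derivative
    (\<Sum>s\<in>UNIV. occupancy \<mu> p s * (\<Sum>a\<in>UNIV. w $ s $ a * advantage p s a))) (at 0)"
proof -
  let ?g = "\<lambda>h. \<Sum>s\<in>UNIV. occupancy \<mu> (p + h *\<^sub>R w) s * (\<Sum>a\<in>UNIV. w $ s $ a * advantage p s a)"
  have pol: "\<forall>\<^sub>F h in at 0. p + h *\<^sub>R w \<in> policies"
    using eventually_policies_along_tangent[OF p w] by (rule eventually_at_filter[THEN iffD2, OF eventually_mono]) simp
  have "((\<lambda>h. p + h *\<^sub>R w) \<longlongrightarrow> p + 0 *\<^sub>R w) (at 0)"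
    by (intro tendsto_intros)
  then have "((\<lambda>h. occupancy \<mu> (p + h *\<^sub>R w) s) \<longlongrightarrow> occupancy \<mu> p s) (at 0)" for s
    using positive_policiesD(1)[OF p] pol
    by (intro continuous_on_tendsto_compose[OF continuous_on_occupancy]) simp_all
  then have lim: "(?g \<longlongrightarrow> (\<Sum>s\<in>UNIV. occupancy \<mu> p s * (\<Sum>a\<in>UNIV. w $ s $ a * advantage p s a))) (at 0)"
    by (intro tendsto_intros)
  have "\<forall>\<^sub>F h in at 0. ?g h = (R \<mu> (p + h *\<^sub>R w) - R \<mu> p) / h"
    using pol eventually_neq_at_within[of 0]
  proof eventually_elim
    case (elim h)
    have "(\<Sum>a\<in>UNIV. (p + h *\<^sub>R w) $ s $ a * advantage p s a) =
        h * (\<Sum>a\<in>UNIV. w $ s $ a * advantage p s a)" for s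
      using sum_advantage[OF positive_policiesD(1)[OF p], of s]
      by (simp add: distrib_right sum.distrib sum_distrib_left mult.assoc)
    then have "R \<mu> (p + h *\<^sub>R w) - R \<mu> p = h * ?g h"
      unfolding performance_difference[OF positive_policiesD(1)[OF p] elim(1)]
      by (simp add: sum_distrib_left mult_ac)
    then show ?case using elim(2) by simp
  qed
  then show ?thesis
    unfolding has_field_derivative_iff using tendsto_cong[THEN iffD1, OF _ lim] by simp
qed

text \<open>
  Two tangent vectors that represent the same derivative differ by a vector that is orthogonal to
  itself; positivity of all occupancies and policy entries makes the metric definite.
\<close>

lemma kakade_gradient_eq:
  assumes p: "p \<in> positive_policies" and d: "\<And>s. 0 < occupancy \<mu> p s"
  shows "kakade_gradient P r \<gamma> \<mu> p = advantage_field p"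
  unfolding kakade_gradient_def
proof (rule the_equality)
  show "advantage_field p \<in> policy_tangent \<and> (\<forall>w\<in>policy_tangent.
      ((\<lambda>h. R \<mu> (p + h *\<^sub>R w)) has_real_derivative kakade_metric P \<gamma> \<mu> p (advantage_field p) w) (at 0))"
    using reward_has_derivative_along_tangent[OF p] advantage_field_tangent[OF positive_policiesD(1)[OF p]]
    by (simp add: kakade_metric_advantage_field[OF p])
next
  fix v assume v: "v \<in> policy_tangent \<and> (\<forall>w\<in>policy_tangent.
      ((\<lambda>h. R \<mu> (p + h *\<^sub>R w)) has_real_derivative kakade_metric P \<gamma> \<mu> p v w) (at 0))"
  define u where "u = v - advantage_field p"
  have w: "u \<in> policy_tangent"
    using v advantage_field_tangent[OF positive_policiesD(1)[OF p]] by (simp add: policy_tangent_def u_def sum_subtractf)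
  have "kakade_metric P \<gamma> \<mu> p v u = kakade_metric P \<gamma> \<mu> p (advantage_field p) u"
    unfolding kakade_metric_advantage_field[OF p]
    using v w by (blast intro: DERIV_unique reward_has_derivative_along_tangent[OF p w])
  moreover have "kakade_metric P \<gamma> \<mu> p (v - v') w = kakade_metric P \<gamma> \<mu> p v w - kakade_metric P \<gamma> \<mu> p v' w" for v' w
    by (simp add: kakade_metric_def left_diff_distrib diff_divide_distrib right_diff_distrib sum_subtractf)
  ultimately have "kakade_metric P \<gamma> \<mu> p u u = 0"
    unfolding u_def by simp
  moreover have nn: "0 \<le> u $ s $ a * u $ s $ a / p $ s $ a" for s a
    using positive_policiesD(2)[OF p, of s a] by (intro divide_nonneg_pos) auto
  ultimately have sq: "u $ s $ a * u $ s $ a / p $ s $ a = 0" for s a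
  proof -
    have "\<forall>s\<in>UNIV. occupancy \<mu> p s * (\<Sum>a\<in>UNIV. u $ s $ a * u $ s $ a / p $ s $ a) = 0"
      using \<open>kakade_metric P \<gamma> \<mu> p u u = 0\<close> unfolding kakade_metric_def
      by (subst (asm) sum_nonneg_eq_0_iff) (auto intro!: mult_nonneg_nonneg sum_nonneg nn less_imp_le[OF d])
    then have "(\<Sum>a\<in>UNIV. u $ s $ a * u $ s $ a / p $ s $ a) = 0"
      using d[of s] by (auto dest: spec[of _ s])
    then show ?thesis using nn by (subst (asm) sum_nonneg_eq_0_iff) auto
  qed
  have "u $ s $ a = 0" for s a
    using sq[of s a] positive_policiesD(2)[OF p, of s a] by simp
  then show "v = advantage_field p" by (simp add: u_def vec_eq_iff)
qed

end

section \<open>Log-sum-exp\<close>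

lemma log_sum_exp_nonexpansive:
  fixes w x y :: "'a::finite \<Rightarrow> real"
  assumes w: "\<And>a. 0 < w a" and xy: "\<And>a. \<bar>x a - y a\<bar> \<le> c"
  shows "\<bar>ln (\<Sum>a\<in>UNIV. w a * exp (x a)) - ln (\<Sum>a\<in>UNIV. w a * exp (y a))\<bar> \<le> c"
proof -
  have pos: "0 < (\<Sum>a\<in>UNIV. w a * exp (x a))" for x
    by (intro sum_pos) (auto simp: w)
  have le: "ln (\<Sum>a\<in>UNIV. w a * exp (x a)) \<le> ln (\<Sum>a\<in>UNIV. w a * exp (y a)) + c"
    if "\<And>a. x a \<le> y a + c" for x y
  proof -
    have "(\<Sum>a\<in>UNIV. w a * exp (x a)) \<le> (\<Sum>a\<in>UNIV. w a * exp (y a + c))"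
      using w that by (intro sum_mono mult_left_mono) (auto simp: less_imp_le)
    also have "\<dots> = (\<Sum>a\<in>UNIV. w a * exp (y a)) * exp c"
      by (simp add: exp_add sum_distrib_left mult_ac)
    finally have "ln (\<Sum>a\<in>UNIV. w a * exp (x a)) \<le> ln ((\<Sum>a\<in>UNIV. w a * exp (y a)) * exp c)"
      using pos[of x] by simp
    then show ?thesis using pos[of y] by (simp add: ln_mult)
  qed
  have "x a \<le> y a + c" "y a \<le> x a + c" for a using xy[of a] by linarith+
  then show ?thesis using le[of x y] le[of y x] by (simp add: abs_le_iff)
qed

text \<open>
  For negative \<open>x = - y\<close> the claim reads \<open>1 \<le> (1 - y + y\<^sup>2) * exp y\<close>, which follows from
  \<open>(1 - y + y\<^sup>2) * (1 + y) = 1 + y ^ 3\<close>.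
\<close>

lemma exp_le_quadratic:
  fixes x :: real
  assumes "\<bar>x\<bar> \<le> 1"
  shows "exp x \<le> 1 + x + x\<^sup>2"
proof (cases "0 \<le> x")
  case True
  then show ?thesis using assms by (intro exp_bound) auto
next
  case False
  define y where "y = - x"
  have y: "0 < y" using False by (simp add: y_def)
  have "1 \<le> (1 - y + y\<^sup>2) * (1 + y)"
    using y by (simp add: algebra_simps power2_eq_square)
  also have "\<dots> \<le> (1 - y + y\<^sup>2) * exp y"
  proof (rule mult_left_mono)
    have "0 \<le> (1 - y / 2)\<^sup>2 + 3 / 4 * y\<^sup>2" by simp
    also have "\<dots> = 1 - y + y\<^sup>2" by (simp add: power2_eq_square algebra_simps)
    finally show "0 \<le> 1 - y + y\<^sup>2" .
  qed (rule exp_ge_add_one_self)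
  finally show ?thesis by (simp add: y_def exp_minus field_simps)
qed

text \<open>
  The lower bound is Jensen's inequality, obtained by exponentiating \<open>1 + y \<le> exp y\<close> around the mean;
  the upper bound combines \<open>exp y \<le> 1 + y + y\<^sup>2\<close> with \<open>ln z \<le> z - 1\<close>.
\<close>

lemma log_sum_exp_expansion:
  fixes w x :: "'a::finite \<Rightarrow> real"
  assumes w: "\<And>a. 0 < w a" "(\<Sum>a\<in>UNIV. w a) = 1" and x: "\<And>a. \<bar>x a\<bar> \<le> c" and c: "c \<le> 1"
  shows "\<bar>ln (\<Sum>a\<in>UNIV. w a * exp (x a)) - (\<Sum>a\<in>UNIV. w a * x a)\<bar> \<le> c\<^sup>2"
proof -
  define m where "m = (\<Sum>a\<in>UNIV. w a * x a)"
  let ?Z = "\<Sum>a\<in>UNIV. w a * exp (x a)"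
  have Z: "0 < ?Z" by (intro sum_pos) (auto simp: w)
  \<comment> \<open>The linear term vanishes because \<open>m\<close> is the mean.\<close>
  have "exp m = (\<Sum>a\<in>UNIV. w a * (exp m * (1 + (x a - m))))"
    using w(2) by (simp add: m_def distrib_left right_diff_distrib sum.distrib sum_subtractf
        mult.left_commute[of "w _" "exp _"] flip: sum_distrib_left sum_distrib_right)
  also have "\<dots> \<le> (\<Sum>a\<in>UNIV. w a * (exp m * exp (x a - m)))"
    using w(1) by (intro sum_mono mult_left_mono exp_ge_add_one_self) (auto simp: less_imp_le)
  also have "\<dots> = ?Z" by (simp flip: exp_add)
  finally have lower: "m \<le> ln ?Z" using Z by (simp add: ln_ge_iff)
  have "?Z \<le> (\<Sum>a\<in>UNIV. w a * (1 + x a + c\<^sup>2))"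
  proof (intro sum_mono mult_left_mono)
    fix a
    have "exp (x a) \<le> 1 + x a + (x a)\<^sup>2" using x[of a] c by (intro exp_le_quadratic) linarith
    moreover have "(x a)\<^sup>2 \<le> c\<^sup>2" using x[of a] by (rule abs_le_square_iff[THEN iffD1, OF order_trans]) simp
    ultimately show "exp (x a) \<le> 1 + x a + c\<^sup>2" by simp
  qed (simp add: w less_imp_le)
  also have "\<dots> = 1 + (m + c\<^sup>2)"
    using w(2) by (simp add: m_def distrib_left sum.distrib flip: sum_distrib_right)
  finally have "ln ?Z \<le> m + c\<^sup>2"
    using Z ln_le_minus_one[OF Z] by linarith
  with lower show ?thesis by (simp add: m_def abs_le_iff)
qed

section \<open>The path of soft policies\<close>

lemma has_vector_derivative_vecI:
  assumes "\<And>i. ((\<lambda>t. f t $ i) has_vector_derivative f' $ i) (at t within S)"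
  shows "(f has_vector_derivative f') (at t within S)"
proof -
  have "((\<lambda>y. (1 / norm (y - t)) *\<^sub>R (f y - (f t + (y - t) *\<^sub>R f'))) \<longlongrightarrow> 0) (at t within S)"
    using assms by (intro vec_tendstoI) (simp add: has_vector_derivative_def has_derivative_within)
  then show ?thesis
    by (simp add: has_vector_derivative_def has_derivative_within bounded_linear_scaleR_left)
qed

context discounted_mdp
begin

context
  fixes p0 :: "real ^ 'a ^ 's"
  assumes p0: "p0 \<in> positive_policies"
begin

text \<open>
  The fixed point of the entropy-regularised Bellman equation with reference policy \<open>p0\<close> and inverse
  temperature \<open>t\<close>. It is \<open>t\<close> times the usual soft value; in this scaling it makes sense for all real
  \<open>t\<close>, vanishes at \<open>t = 0\<close>, and has the unregularised value of the current policy as derivative.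
\<close>

definition soft_value :: "real \<Rightarrow> 's \<Rightarrow> real" where
  "soft_value t = (THE u. \<forall>s. u s = ln (\<Sum>a\<in>UNIV. p0 $ s $ a * exp (backup t u s a)))"

lemma soft_value_ex1: "\<exists>!u. \<forall>s. u s = ln (\<Sum>a\<in>UNIV. p0 $ s $ a * exp (backup t u s a))"
proof (rule sup_contraction_ex1_fixpoint[OF discount])
  fix u v :: "'s \<Rightarrow> real" and c s assume "\<And>s. \<bar>u s - v s\<bar> \<le> c"
  then have "\<bar>backup t u s a - backup t v s a\<bar> \<le> \<gamma> * c" for a
    by (simp add: backup_diff abs_backup_0_le)
  then show "\<bar>ln (\<Sum>a\<in>UNIV. p0 $ s $ a * exp (backup t u s a)) -
      ln (\<Sum>a\<in>UNIV. p0 $ s $ a * exp (backup t v s a))\<bar> \<le> \<gamma> * c"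
    by (intro log_sum_exp_nonexpansive positive_policiesD(2)[OF p0])
qed

lemma soft_value_eqI:
  assumes "\<And>s. u s = ln (\<Sum>a\<in>UNIV. p0 $ s $ a * exp (backup t u s a))"
  shows "u = soft_value t"
  unfolding soft_value_def using assms soft_value_ex1 by (intro the1_equality[symmetric]) blast+

lemma exp_soft_value: "exp (soft_value t s) = (\<Sum>a\<in>UNIV. p0 $ s $ a * exp (backup t (soft_value t) s a))"
proof -
  have "soft_value t s = ln (\<Sum>a\<in>UNIV. p0 $ s $ a * exp (backup t (soft_value t) s a))"
    using theI'[OF soft_value_ex1[of t]] unfolding soft_value_def by blast
  moreover have "0 < (\<Sum>a\<in>UNIV. p0 $ s $ a * exp (backup t (soft_value t) s a))"
    by (intro sum_pos) (auto simp: positive_policiesD(2)[OF p0])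
  ultimately show ?thesis by (metis exp_ln)
qed

text \<open>
  The Gibbs policy of the soft value. It is simultaneously the solution of the gradient flow and the
  central path of the regularised problems.
\<close>

definition soft_policy :: "real \<Rightarrow> real ^ 'a ^ 's" where
  "soft_policy t = (\<chi> s a. p0 $ s $ a * exp (backup t (soft_value t) s a - soft_value t s))"

lemma soft_policy_nth:
  "soft_policy t $ s $ a = p0 $ s $ a * exp (backup t (soft_value t) s a - soft_value t s)"
  by (simp add: soft_policy_def)

lemma soft_policy_positive: "soft_policy t \<in> positive_policies"
proof -
  have pos: "0 < soft_policy t $ s $ a" for s a
    using positive_policiesD(2)[OF p0] by (simp add: soft_policy_nth)
  have "(\<Sum>a\<in>UNIV. soft_policy t $ s $ a) = 1" for s
  proof -
    have "(\<Sum>a\<in>UNIV. soft_policy t $ s $ a) =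
        (\<Sum>a\<in>UNIV. p0 $ s $ a * exp (backup t (soft_value t) s a)) / exp (soft_value t s)"
      by (simp add: soft_policy_nth exp_diff sum_divide_distrib)
    also have "\<dots> = 1" by (simp flip: exp_soft_value)
    finally show ?thesis .
  qed
  then show ?thesis
    using pos by (simp add: positive_policies_def policies_def prob_simplex_def less_imp_le)
qed

lemmas soft_policy_policies = positive_policiesD(1)[OF soft_policy_positive]

lemma soft_policy_0: "soft_policy 0 = p0"
proof -
  have "(\<lambda>_. 0) = soft_value 0"
    using policiesD(2)[OF positive_policiesD(1)[OF p0]] by (intro soft_value_eqI) (simp add: backup_def)
  then have "soft_value 0 s = 0" for s by metis
  then show ?thesis by (simp add: vec_eq_iff soft_policy_nth backup_def)
qed

lemma backup_has_derivative:
  assumes "\<And>s. ((\<lambda>t. u t s) has_real_derivative u' s) (at t within S)"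
  shows "((\<lambda>t. backup t (u t) s a) has_real_derivative backup 1 u' s a) (at t within S)"
  unfolding backup_def
  by (intro DERIV_add DERIV_cmult_right DERIV_ident DERIV_cmult DERIV_sum assms)

text \<open>
  Differentiating the fixed-point equation formally gives the Bellman equation of the current policy
  for the derivative. To justify this, compare the increment with that derivative directly: the increment \<open>D\<close> of
  the soft value is itself the log-sum-exp of its backup under the current policy, the contraction
  bounds \<open>D\<close> by a multiple of \<open>\<bar>h\<bar>\<close>, the second-order expansion replaces log-sum-exp by the mean,
  and the contraction once more bounds \<open>D - h * V\<close> by a multiple of \<open>h\<^sup>2\<close>.
\<close>

lemma soft_value_has_derivative:
  "((\<lambda>t. soft_value t s) has_real_derivative policy_value (soft_policy t) s) (at t)"
proof -
  let ?\<pi> = "soft_policy t" and ?V = "policy_value (soft_policy t)"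
  note pi = policiesD[OF soft_policy_policies[of t]] positive_policiesD(2)[OF soft_policy_positive[of t]]
  define \<rho> where "\<rho> = Max (range (\<lambda>(s, a). \<bar>r s a\<bar>))"
  have \<rho>: "\<bar>r s a\<bar> \<le> \<rho>" for s a
    unfolding \<rho>_def by (intro Max_ge) auto
  have \<rho>0: "0 \<le> \<rho>" using abs_ge_zero \<rho> order_trans by blast
  \<comment> \<open>A common bound for all values, and the Lipschitz constant of the soft value in \<open>t\<close>.\<close>
  define C where "C = \<rho> / (1 - \<gamma>)"
  have C0: "0 \<le> C" using \<rho>0 discount by (simp add: C_def)
  have bound: "\<bar>(soft_value (t + h) s - soft_value t s) - h * ?V s\<bar> \<le> (\<bar>h\<bar> * C)\<^sup>2 / (1 - \<gamma>)"
    if h: "\<bar>h\<bar> * C \<le> 1" for h s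
  proof -
    define D where "D = (\<lambda>s. soft_value (t + h) s - soft_value t s)"
    have x: "backup h D s a = backup (t + h) (soft_value (t + h)) s a - backup t (soft_value t) s a" for s a
      by (simp add: backup_diff D_def)
    have D: "D s = ln (\<Sum>a\<in>UNIV. ?\<pi> $ s $ a * exp (backup h D s a))" for s
    proof -
      have "(\<Sum>a\<in>UNIV. ?\<pi> $ s $ a * exp (backup h D s a)) =
          (\<Sum>a\<in>UNIV. p0 $ s $ a * exp (backup (t + h) (soft_value (t + h)) s a)) / exp (soft_value t s)"
        by (simp add: soft_policy_nth x exp_diff sum_divide_distrib)
      also have "\<dots> = exp (D s)"
        by (simp add: D_def exp_diff flip: exp_soft_value)
      finally show ?thesis by simp
    qed
    have Dle: "\<bar>D s\<bar> \<le> \<bar>h\<bar> * \<rho> / (1 - \<gamma>)" for s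
    proof (rule sup_contraction_bound[OF discount(2)])
      fix c s assume "\<And>s. \<bar>D s\<bar> \<le> c"
      then have "\<bar>backup h D s a - 0\<bar> \<le> \<bar>h\<bar> * \<rho> + \<gamma> * c" for a
        using abs_backup_le[OF \<rho>] by simp
      from log_sum_exp_nonexpansive[of "\<lambda>a. ?\<pi> $ s $ a" "\<lambda>a. backup h D s a" "\<lambda>_. 0", OF pi(3) this]
      show "\<bar>D s\<bar> \<le> \<bar>h\<bar> * \<rho> + \<gamma> * c"
        using pi(2) by (simp add: D[of s, symmetric])
    qed
    have xle: "\<bar>backup h D s a\<bar> \<le> \<bar>h\<bar> * C" for s a
    proof -
      have "\<bar>backup h D s a\<bar> \<le> \<bar>h\<bar> * \<rho> + \<gamma> * (\<bar>h\<bar> * \<rho> / (1 - \<gamma>))"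
        by (rule abs_backup_le[OF \<rho> Dle])
      also have "\<dots> = \<bar>h\<bar> * C" using discount by (simp add: C_def field_simps)
      finally show ?thesis .
    qed
    have "\<bar>D s - h * ?V s\<bar> \<le> (\<bar>h\<bar> * C)\<^sup>2 / (1 - \<gamma>)" for s
    proof (rule sup_contraction_bound[OF discount(2)])
      fix c s assume *: "\<And>s. \<bar>D s - h * ?V s\<bar> \<le> c"
      let ?m = "\<Sum>a\<in>UNIV. ?\<pi> $ s $ a * backup h D s a"
      have "h * ?V s = (\<Sum>a\<in>UNIV. ?\<pi> $ s $ a * backup h (\<lambda>s. h * ?V s) s a)"
        by (subst policy_value_bellman[OF soft_policy_policies])
           (simp add: sum_distrib_left backup_cmult[of h 1, simplified] mult_ac)
      then have "?m - h * ?V s = (\<Sum>a\<in>UNIV. ?\<pi> $ s $ a * backup 0 (\<lambda>s. D s - h * ?V s) s a)"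
        by (simp add: backup_diff[of h _ _ _ h, simplified, symmetric] right_diff_distrib sum_subtractf)
      also have "\<bar>\<dots>\<bar> \<le> \<gamma> * c"
        using pi by (intro abs_convex_comb_le abs_backup_0_le *) auto
      finally have "\<bar>?m - h * ?V s\<bar> \<le> \<gamma> * c" .
      moreover have "\<bar>D s - ?m\<bar> \<le> (\<bar>h\<bar> * C)\<^sup>2"
        unfolding D[of s] by (rule log_sum_exp_expansion[OF pi(3) pi(2) xle h])
      ultimately show "\<bar>D s - h * ?V s\<bar> \<le> (\<bar>h\<bar> * C)\<^sup>2 + \<gamma> * c" by linarith
    qed
    then show ?thesis by (simp add: D_def)
  qed
  let ?K = "C\<^sup>2 / (1 - \<gamma>)"
  have "((\<lambda>h. \<bar>h\<bar> * C) \<longlongrightarrow> \<bar>0\<bar> * C) (at 0)" by (intro tendsto_intros)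
  then have "\<forall>\<^sub>F h in at 0. \<bar>h\<bar> * C < 1" by (rule order_tendstoD) simp
  then have "\<forall>\<^sub>F h in at 0. norm ((soft_value (t + h) s - soft_value t s) / h - ?V s) \<le> \<bar>h\<bar> * ?K"
    using eventually_neq_at_within[of 0]
  proof eventually_elim
    case (elim h)
    have "(soft_value (t + h) s - soft_value t s) / h - ?V s = ((soft_value (t + h) s - soft_value t s) - h * ?V s) / h"
      using elim by (simp add: field_simps)
    also have "\<bar>\<dots>\<bar> \<le> (\<bar>h\<bar> * C)\<^sup>2 / (1 - \<gamma>) / \<bar>h\<bar>"
      unfolding abs_divide using elim by (intro divide_right_mono bound) auto
    also have "\<dots> = \<bar>h\<bar> * ?K"
      using elim by (simp add: power2_eq_square)
    finally show ?case by simp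
  qed
  moreover have "((\<lambda>h. \<bar>h\<bar> * ?K) \<longlongrightarrow> 0) (at 0)"
    by (rule tendsto_eq_intros refl | simp)+
  ultimately have "((\<lambda>h. (soft_value (t + h) s - soft_value t s) / h - ?V s) \<longlongrightarrow> 0) (at 0)"
    by (rule Lim_null_comparison)
  then show ?thesis
    by (simp add: DERIV_def Lim_null[symmetric])
qed

lemma soft_policy_has_vector_derivative:
  "(soft_policy has_vector_derivative advantage_field (soft_policy t)) (at t within S)"
proof (intro has_vector_derivative_vecI)
  fix s a
  have "((\<lambda>t. p0 $ s $ a * exp (backup t (soft_value t) s a - soft_value t s)) has_real_derivative
      p0 $ s $ a * (exp (backup t (soft_value t) s a - soft_value t s) *
        (backup 1 (policy_value (soft_policy t)) s a - policy_value (soft_policy t) s))) (at t within S)"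
    by (rule derivative_eq_intros backup_has_derivative DERIV_subset[OF soft_value_has_derivative]
        subset_UNIV refl)+ simp
  then show "((\<lambda>t. soft_policy t $ s $ a) has_vector_derivative advantage_field (soft_policy t) $ s $ a) (at t within S)"
    by (simp add: soft_policy_nth advantage_def mult.assoc has_real_derivative_iff_has_vector_derivative)
qed

text \<open>
  With the soft value as potential, the logarithm of \<open>soft_policy t\<close> over \<open>p0\<close> is exactly the shaped
  reward. Hence the regularised objective is, up to a constant, minus the divergence to the soft
  policy.
\<close>

lemma regularised_reward_eq:
  assumes q: "q \<in> policies"
  shows "t * R \<mu> q - DK \<mu> q p0 = (1 - \<gamma>) * (\<Sum>s\<in>UNIV. pmf \<mu> s * soft_value t s) - DK \<mu> q (soft_policy t)"
proof -
  have "KL_div (q $ s) (p0 $ s) - KL_div (q $ s) (soft_policy t $ s) =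
      (\<Sum>a\<in>UNIV. q $ s $ a * (backup t (soft_value t) s a - soft_value t s))" for s
  proof -
    have "ln (soft_policy t $ s $ a / p0 $ s $ a) = backup t (soft_value t) s a - soft_value t s" for a
      using positive_policiesD(2)[OF p0, of s a] by (simp add: soft_policy_nth)
    then show ?thesis
      by (subst KL_div_diff) (use q p0 soft_policy_positive in \<open>auto simp: policies_nth positive_policiesD\<close>)
  qed
  then have "DK \<mu> q p0 - DK \<mu> q (soft_policy t) =
      (\<Sum>s\<in>UNIV. occupancy \<mu> q s * (\<Sum>a\<in>UNIV. q $ s $ a * (backup t (soft_value t) s a - soft_value t s)))"
    by (simp add: kakade_div_def flip: sum_subtractf right_diff_distrib)
  then show ?thesis using reward_eq_potential[OF q, of t \<mu> "soft_value t"] by simp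
qed

lemma DK_refl: "q \<in> positive_policies \<Longrightarrow> DK \<mu> q q = 0"
proof -
  assume q: "q \<in> positive_policies"
  have "q $ s $ a \<noteq> 0" for s a using positive_policiesD(2)[OF q, of s a] by simp
  then show ?thesis by (simp add: kakade_div_def KL_div_def)
qed

text \<open>
  The Pythagorean identity of the path, from which the central path property, the convergence rate and
  the implicit bias are all read off.
\<close>

lemma three_point_identity:
  assumes q: "q \<in> policies"
  shows "t * (R \<mu> q - R \<mu> (soft_policy t)) = DK \<mu> q p0 - DK \<mu> (soft_policy t) p0 - DK \<mu> q (soft_policy t)"
  using regularised_reward_eq[OF q, of t \<mu>] regularised_reward_eq[OF soft_policy_policies[of t], of t \<mu>]
    DK_refl[OF soft_policy_positive[of t], of \<mu>]
  by (simp add: right_diff_distrib)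

lemma soft_policy_is_kakade_flow:
  assumes d: "\<And>p s. p \<in> positive_policies \<Longrightarrow> 0 < occupancy \<mu> p s"
  shows "kakade_flow P r \<gamma> \<mu> p0 soft_policy"
  unfolding kakade_flow_def rel_interior_policies
  using soft_policy_0 soft_policy_positive soft_policy_has_vector_derivative
  by (simp add: positive_policies_def kakade_gradient_eq[OF soft_policy_positive d[OF soft_policy_positive]])

text \<open>
  For a given flow \<open>\<psi>\<close>, let \<open>U t\<close> be the time integral of the values of \<open>\<psi>\<close>. The flow equation
  integrates to \<open>\<psi> t = p0 * exp (backup t (U t) - U t)\<close>, and since each row of \<open>\<psi> t\<close> sums to 1, \<open>U t\<close>
  solves the fixed-point equation that determines the soft value.
\<close>

lemma kakade_flow_unique:
  assumes d: "\<And>p s. p \<in> positive_policies \<Longrightarrow> 0 < occupancy \<mu> p s"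
    and flow: "kakade_flow P r \<gamma> \<mu> p0 \<psi>" and T: "0 \<le> T"
  shows "\<psi> T = soft_policy T"
proof -
  have int: "\<psi> t \<in> positive_policies" if "0 \<le> t" for t
    using flow that by (simp add: kakade_flow_def rel_interior_policies positive_policies_def)
  have der: "(\<psi> has_vector_derivative advantage_field (\<psi> t)) (at t within {0..})" if "0 \<le> t" for t
  proof -
    have "(\<psi> has_vector_derivative kakade_gradient P r \<gamma> \<mu> (\<psi> t)) (at t within {0..})"
      using flow that by (simp add: kakade_flow_def)
    then show ?thesis by (simp only: kakade_gradient_eq[OF int[OF that] d[OF int[OF that]]])
  qed
  have der_nth: "((\<lambda>t. \<psi> t $ s $ a) has_real_derivative \<psi> t $ s $ a * advantage (\<psi> t) s a) (at t within {0..T})"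
    if "t \<in> {0..T}" for t s a
  proof -
    have "((\<lambda>t. \<psi> t $ s $ a) has_vector_derivative advantage_field (\<psi> t) $ s $ a) (at t within {0..})"
      using that by (intro bounded_linear.has_vector_derivative[OF bounded_linear_vec_nth] der) auto
    then show ?thesis
      by (auto simp: has_real_derivative_iff_has_vector_derivative intro: has_vector_derivative_within_subset)
  qed
  define U where "U t s = integral {0..t} (\<lambda>u. policy_value (\<psi> u) s)" for t s
  have "continuous (at t within {0..T}) \<psi>" if "t \<in> {0..T}" for t
    by (rule continuous_within_subset[OF has_vector_derivative_continuous[OF der]]) (use that in auto)
  then have "continuous_on {0..T} \<psi>"
    by (simp add: continuous_on_eq_continuous_within)
  then have "continuous_on {0..T} (\<lambda>u. policy_value (\<psi> u) s)" for s
    by (rule continuous_on_compose2[OF continuous_on_policy_value]) (auto simp: positive_policiesD(1)[OF int])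
  then have derU: "((\<lambda>t. U t s) has_real_derivative policy_value (\<psi> t) s) (at t within {0..T})"
    if "t \<in> {0..T}" for t s
    unfolding U_def has_real_derivative_iff_has_vector_derivative
    using that by (rule integral_has_vector_derivative)
  have \<psi>: "\<psi> t $ s $ a = p0 $ s $ a * exp (backup t (U t) s a - U t s)" if t: "t \<in> {0..T}" for t s a
  proof -
    \<comment> \<open>An integrating factor: the derivatives of both factors cancel.\<close>
    let ?g = "\<lambda>t. \<psi> t $ s $ a * exp (- (backup t (U t) s a - U t s))"
    have "(?g has_real_derivative 0) (at t within {0..T})" if t: "t \<in> {0..T}" for t
    proof -
      have "((\<lambda>t. backup t (U t) s a - U t s) has_real_derivative advantage (\<psi> t) s a) (at t within {0..T})"
        unfolding advantage_def by (intro DERIV_diff backup_has_derivative derU[OF t])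
      from DERIV_mult[OF der_nth[OF t, of s a] DERIV_chain2[OF DERIV_exp DERIV_minus[OF this]]]
      show ?thesis by (simp add: algebra_simps)
    qed
    then have "\<exists>c. \<forall>t\<in>{0..T}. ?g t = c"
      by (intro has_field_derivative_zero_constant) auto
    moreover have "?g 0 = p0 $ s $ a"
      using flow by (simp add: kakade_flow_def backup_def U_def)
    ultimately have "?g t = p0 $ s $ a" using t T by force
    then show ?thesis
      by (simp only: exp_minus) (simp add: field_simps del: minus_diff_eq)
  qed
  have "U T = soft_value T"
  proof (rule soft_value_eqI)
    fix s
    have "(\<Sum>a\<in>UNIV. p0 $ s $ a * exp (backup T (U T) s a)) = exp (U T s) * (\<Sum>a\<in>UNIV. \<psi> T $ s $ a)"
      using T by (simp add: \<psi> sum_distrib_left exp_diff)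
    then show "U T s = ln (\<Sum>a\<in>UNIV. p0 $ s $ a * exp (backup T (U T) s a))"
      using policiesD(2)[OF positive_policiesD(1)[OF int[OF T]]] by simp
  qed
  then show ?thesis
    using T by (simp add: vec_eq_iff \<psi> soft_policy_nth)
qed

end

end

section \<open>Optimal policies and the limit of the path\<close>

text \<open>
  In a compact set, a function that does not tend to \<open>l\<close> has a cluster point other than \<open>l\<close>.
\<close>

lemma tendsto_at_top_if_unique_cluster_point:
  fixes f :: "real \<Rightarrow> 'b::metric_space"
  assumes K: "compact K" "\<And>t. f t \<in> K"
    and uniq: "\<And>X q. filterlim X at_top sequentially \<Longrightarrow> (\<lambda>n. f (X n)) \<longlonglongrightarrow> q \<Longrightarrow> q = l"
  shows "(f \<longlongrightarrow> l) at_top"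
proof (rule tendsto_at_topI_sequentially)
  fix X :: "nat \<Rightarrow> real" assume X: "filterlim X at_top sequentially"
  show "(\<lambda>n. f (X n)) \<longlonglongrightarrow> l"
  proof (rule ccontr)
    assume "\<not> ?thesis"
    then obtain e where e: "0 < e" "\<not> (\<forall>\<^sub>F n in sequentially. dist (f (X n)) l < e)"
      unfolding tendsto_iff by blast
    then have "\<exists>\<^sub>\<infinity>n. \<not> dist (f (X n)) l < e"
      by (simp add: not_eventually cofinite_eq_sequentially)
    then have "infinite {n. \<not> dist (f (X n)) l < e}" by (simp add: INFM_iff_infinite)
    then obtain \<sigma> :: "nat \<Rightarrow> nat" where \<sigma>: "strict_mono \<sigma>" "\<And>n. \<sigma> n \<in> {n. \<not> dist (f (X n)) l < e}"
      using infinite_enumerate by blast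
    obtain q \<tau> where \<tau>: "strict_mono \<tau>" "((\<lambda>n. f (X (\<sigma> n))) \<circ> \<tau>) \<longlonglongrightarrow> q"
      using K unfolding compact_def by (metis)
    have "filterlim (\<lambda>n. \<sigma> (\<tau> n)) sequentially sequentially"
      using filterlim_subseq[OF strict_mono_o[OF \<sigma>(1) \<tau>(1)]] by (simp add: o_def)
    then have "filterlim (\<lambda>n. X (\<sigma> (\<tau> n))) at_top sequentially"
      by (rule filterlim_compose[OF X])
    then have "q = l" using \<tau>(2) by (intro uniq) (simp_all add: o_def)
    then have "\<forall>\<^sub>F n in sequentially. dist (f (X (\<sigma> (\<tau> n)))) l < e"
      using tendstoD[OF \<tau>(2) e(1)] by (simp add: o_def)
    then show False using \<sigma>(2) by (auto dest!: eventually_happens)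
  qed
qed

context discounted_mdp
begin

abbreviation Rmax :: "'s pmf \<Rightarrow> real" where "Rmax \<mu> \<equiv> max_reward P r \<gamma> \<mu>"

abbreviation optimal :: "'s pmf \<Rightarrow> (real ^ 'a ^ 's) set" where
  "optimal \<mu> \<equiv> optimal_policies P r \<gamma> \<mu>"

context
  fixes p0 :: "real ^ 'a ^ 's"
  assumes p0: "p0 \<in> positive_policies"
begin

abbreviation Dmin :: "'s pmf \<Rightarrow> real" where
  "Dmin \<mu> \<equiv> min_optimal_div P r \<gamma> \<mu> p0"

lemma max_reward_attained: "\<exists>p\<in>policies. R \<mu> p = Rmax \<mu>"
  and reward_le_max: "q \<in> policies \<Longrightarrow> R \<mu> q \<le> Rmax \<mu>"
proof -
  obtain p where p: "p \<in> policies" "\<And>q. q \<in> policies \<Longrightarrow> R \<mu> q \<le> R \<mu> p"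
    using continuous_attains_sup[OF compact_policies _ continuous_on_reward[of \<mu>]] positive_policiesD(1)[OF p0]
    by blast
  then have "Rmax \<mu> = R \<mu> p"
    unfolding max_reward_def by (intro Greatest_equality) auto
  then show "\<exists>p\<in>policies. R \<mu> p = Rmax \<mu>" "q \<in> policies \<Longrightarrow> R \<mu> q \<le> Rmax \<mu>"
    using p by auto
qed

lemma optimalD: "q \<in> optimal \<mu> \<Longrightarrow> q \<in> policies" "q \<in> optimal \<mu> \<Longrightarrow> R \<mu> q = Rmax \<mu>"
  by (simp_all add: optimal_policies_def)

lemma min_div_attained: "\<exists>p\<in>optimal \<mu>. DK \<mu> p p0 = Dmin \<mu>"
  and min_div_le: "q \<in> optimal \<mu> \<Longrightarrow> Dmin \<mu> \<le> DK \<mu> q p0"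
proof -
  have "closedin (top_of_set policies) (policies \<inter> R \<mu> -` {Rmax \<mu>})"
    by (intro continuous_closedin_preimage continuous_on_reward) simp
  then have "compact (optimal \<mu>)"
    using closedin_compact[OF compact_policies]
    by (simp add: optimal_policies_def vimage_def Int_def)
  moreover have "optimal \<mu> \<noteq> {}" using max_reward_attained by (auto simp: optimal_policies_def)
  moreover have "continuous_on (optimal \<mu>) (\<lambda>p. DK \<mu> p p0)"
    by (rule continuous_on_subset[OF continuous_on_DK[OF p0]]) (auto dest: optimalD)
  ultimately obtain p where p: "p \<in> optimal \<mu>" "\<And>q. q \<in> optimal \<mu> \<Longrightarrow> DK \<mu> p p0 \<le> DK \<mu> q p0"
    using continuous_attains_inf by metis
  then have "Dmin \<mu> = DK \<mu> p p0"
    unfolding min_optimal_div_def by (intro Least_equality) auto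
  then show "\<exists>p\<in>optimal \<mu>. DK \<mu> p p0 = Dmin \<mu>" "q \<in> optimal \<mu> \<Longrightarrow> Dmin \<mu> \<le> DK \<mu> q p0"
    using p by auto
qed

lemma is_arg_min_div_iff:
  "is_arg_min (\<lambda>p. DK \<mu> p p0) (\<lambda>p. p \<in> optimal \<mu>) q \<longleftrightarrow> q \<in> optimal \<mu> \<and> DK \<mu> q p0 = Dmin \<mu>"
proof
  assume *: "is_arg_min (\<lambda>p. DK \<mu> p p0) (\<lambda>p. p \<in> optimal \<mu>) q"
  obtain p where p: "p \<in> optimal \<mu>" "DK \<mu> p p0 = Dmin \<mu>" using min_div_attained by blast
  with * have "q \<in> optimal \<mu>" "DK \<mu> q p0 \<le> Dmin \<mu>"
    by (simp_all add: is_arg_min_linorder) metis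
  with min_div_le[of q \<mu>] show "q \<in> optimal \<mu> \<and> DK \<mu> q p0 = Dmin \<mu>" by simp
next
  assume "q \<in> optimal \<mu> \<and> DK \<mu> q p0 = Dmin \<mu>"
  then show "is_arg_min (\<lambda>p. DK \<mu> p p0) (\<lambda>p. p \<in> optimal \<mu>) q"
    using min_div_le by (simp add: is_arg_min_linorder)
qed

abbreviation \<phi> :: "real \<Rightarrow> real ^ 'a ^ 's" where "\<phi> \<equiv> soft_policy p0"

lemmas path = soft_policy_positive[OF p0] soft_policy_policies[OF p0]

text \<open>
  By the identity above, maximising amounts to having divergence 0 to the soft policy. That forces
  equality only on the states visited by \<open>q\<close>, but then both policies have the same occupancy, and the
  soft policy visits every state.
\<close>

lemma central_path:
  assumes d: "\<And>s. 0 < occupancy \<mu> (\<phi> t) s" and t: "0 < t"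
  shows "is_arg_max (\<lambda>p. R \<mu> p - DK \<mu> p p0 / t) (\<lambda>p. p \<in> policies) q \<longleftrightarrow> q = \<phi> t"
proof -
  let ?f = "\<lambda>p. R \<mu> p - DK \<mu> p p0 / t"
  have f: "?f p = ?f (\<phi> t) - DK \<mu> p (\<phi> t) / t" if "p \<in> policies" for p
  proof -
    have "R \<mu> p - R \<mu> (\<phi> t) = (DK \<mu> p p0 - DK \<mu> (\<phi> t) p0 - DK \<mu> p (\<phi> t)) / t"
      using three_point_identity[OF p0 that, of t \<mu>] t by (simp add: eq_divide_eq mult.commute)
    then show ?thesis by (simp add: diff_divide_distrib)
  qed
  have max: "?f p \<le> ?f (\<phi> t)" if "p \<in> policies" for p
    using f[OF that] DK_nonneg[OF that path(1), of \<mu> t] t by simp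
  show ?thesis
  proof
    assume "is_arg_max ?f (\<lambda>p. p \<in> policies) q"
    then have q: "q \<in> policies" and "?f (\<phi> t) \<le> ?f q"
      using path(2)[of t] by (auto simp: is_arg_max_def not_less)
    then have "DK \<mu> q (\<phi> t) / t \<le> 0" using f[OF q] by linarith
    then have "DK \<mu> q (\<phi> t) = 0"
      using DK_nonneg[OF q path(1), of \<mu> t] t by (simp add: divide_le_0_iff)
    then have le: "occupancy \<mu> q s * KL_div (q $ s) (\<phi> t $ s) \<le> 0" for s
      using occupancy_times_KL_le_DK[OF q path(1), of \<mu> s t] by simp
    have eq: "\<phi> t $ s = q $ s" if "0 < occupancy \<mu> q s" for s
    proof (rule KL_div_eq_0_imp_eq[symmetric])
      show simplex: "q $ s \<in> prob_simplex" "\<phi> t $ s \<in> prob_simplex" "0 < \<phi> t $ s $ a" for a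
        using q path by (auto simp: policies_nth positive_policiesD)
      show "KL_div (q $ s) (\<phi> t $ s) = 0"
        using le[of s] that KL_div_nonneg[OF simplex] by (simp add: mult_le_0_iff)
    qed
    with d occupancy_cong[OF path(2) q, of \<mu> t] show "q = \<phi> t"
      by (simp add: vec_eq_iff)
  next
    assume "q = \<phi> t"
    then show "is_arg_max ?f (\<lambda>p. p \<in> policies) q"
      using max path(2) by (auto simp: is_arg_max_def not_less)
  qed
qed

lemma suboptimality_eq:
  assumes "q \<in> optimal \<mu>"
  shows "t * (Rmax \<mu> - R \<mu> (\<phi> t)) = DK \<mu> q p0 - DK \<mu> (\<phi> t) p0 - DK \<mu> q (\<phi> t)"
  using three_point_identity[OF p0 optimalD(1)[OF assms], of t \<mu>] optimalD(2)[OF assms] by simp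

text \<open>
  Apply the identity to an optimal policy closest to \<open>p0\<close> and drop the nonnegative divergence from it
  to the path.
\<close>

lemma suboptimality_le:
  assumes t: "0 < t"
  shows "Rmax \<mu> - R \<mu> (\<phi> t) \<le> (Dmin \<mu> - DK \<mu> (\<phi> t) p0) / t"
proof -
  obtain q where q: "q \<in> optimal \<mu>" "DK \<mu> q p0 = Dmin \<mu>" using min_div_attained by blast
  have "t * (Rmax \<mu> - R \<mu> (\<phi> t)) \<le> Dmin \<mu> - DK \<mu> (\<phi> t) p0"
    using suboptimality_eq[OF q(1), of t] q(2) DK_nonneg[OF optimalD(1)[OF q(1)] path(1), of \<mu> t] by simp
  then show ?thesis using t by (simp add: field_simps)
qed

lemma DK_path_le_Dmin:
  assumes t: "0 < t"
  shows "DK \<mu> (\<phi> t) p0 \<le> Dmin \<mu>"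
proof -
  have "0 \<le> (Dmin \<mu> - DK \<mu> (\<phi> t) p0) / t"
    using suboptimality_le[OF t, of \<mu>] reward_le_max[OF path(2)[of t], of \<mu>] by linarith
  then show ?thesis using t by (simp add: zero_le_divide_iff)
qed

text \<open>
  Along a filter on which the path converges, the rate makes the limit optimal, and the bound
  \<open>DK \<mu> (\<phi> t) p0 \<le> Dmin \<mu>\<close> makes it a minimiser of the divergence. For any other minimiser \<open>p\<close>, the
  divergence of \<open>p\<close> to the path is at most \<open>Dmin \<mu> - DK \<mu> (\<phi> t) p0\<close>, which now tends to 0; so the
  path also converges to \<open>p\<close> wherever \<open>p\<close> goes.
\<close>

lemma path_cluster_point:
  assumes X: "filterlim X at_top F" and F: "F \<noteq> bot" and q: "((\<lambda>i. \<phi> (X i)) \<longlongrightarrow> q) F"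
  shows path_cluster_point_optimal: "q \<in> optimal \<mu>"
    and path_cluster_point_div: "DK \<mu> q p0 = Dmin \<mu>"
    and path_cluster_point_eq:
      "\<lbrakk>p \<in> optimal \<mu>; DK \<mu> p p0 = Dmin \<mu>; 0 < occupancy \<mu> p s\<rbrakk> \<Longrightarrow> p $ s = q $ s"
proof -
  have pol: "q \<in> policies"
    using F q path(2) by (intro Lim_in_closed_set[OF compact_imp_closed[OF compact_policies]]) auto
  have R: "((\<lambda>i. R \<mu> (\<phi> (X i))) \<longlongrightarrow> R \<mu> q) F"
    using path(2) by (intro continuous_on_tendsto_compose[OF continuous_on_reward q pol]) simp
  have D: "((\<lambda>i. DK \<mu> (\<phi> (X i)) p0) \<longlongrightarrow> DK \<mu> q p0) F"
    using path(2) by (intro continuous_on_tendsto_compose[OF continuous_on_DK[OF p0] q pol]) simp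
  have pos: "\<forall>\<^sub>F i in F. 0 < X i"
    using X by (simp add: filterlim_at_top_dense)
  have "((\<lambda>i. Dmin \<mu> / X i) \<longlongrightarrow> 0) F"
    by (rule tendsto_divide_0[OF tendsto_const filterlim_at_top_imp_at_infinity[OF X]])
  moreover have "((\<lambda>i. Rmax \<mu> - R \<mu> (\<phi> (X i))) \<longlongrightarrow> Rmax \<mu> - R \<mu> q) F"
    by (intro tendsto_intros R)
  moreover have "\<forall>\<^sub>F i in F. Rmax \<mu> - R \<mu> (\<phi> (X i)) \<le> Dmin \<mu> / X i"
    using pos
  proof eventually_elim
    case (elim i)
    have "(Dmin \<mu> - DK \<mu> (\<phi> (X i)) p0) / X i \<le> Dmin \<mu> / X i"
      using elim DK_nonneg[OF path(2) p0, of \<mu>] by (intro divide_right_mono) auto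
    then show ?case using suboptimality_le[OF elim, where \<mu> = \<mu>] by linarith
  qed
  ultimately have "Rmax \<mu> - R \<mu> q \<le> 0" by (rule tendsto_le[OF F])
  then show opt: "q \<in> optimal \<mu>"
    using reward_le_max[OF pol, of \<mu>] pol by (simp add: optimal_policies_def)
  have "DK \<mu> q p0 \<le> Dmin \<mu>"
    using pos by (intro tendsto_upperbound[OF D _ F]) (auto elim!: eventually_mono DK_path_le_Dmin)
  then show div: "DK \<mu> q p0 = Dmin \<mu>" using min_div_le[OF opt] by simp
  show "p $ s = q $ s" if p: "p \<in> optimal \<mu>" "DK \<mu> p p0 = Dmin \<mu>" "0 < occupancy \<mu> p s"
  proof -
    have "((\<lambda>i. Dmin \<mu> - DK \<mu> (\<phi> (X i)) p0) \<longlongrightarrow> Dmin \<mu> - DK \<mu> q p0) F"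
      by (intro tendsto_intros D)
    then have lim0: "((\<lambda>i. Dmin \<mu> - DK \<mu> (\<phi> (X i)) p0) \<longlongrightarrow> 0) F" by (simp add: div)
    have upper: "\<forall>\<^sub>F i in F. DK \<mu> p (\<phi> (X i)) \<le> Dmin \<mu> - DK \<mu> (\<phi> (X i)) p0"
      using pos
    proof eventually_elim
      case (elim i)
      have "0 \<le> X i * (Rmax \<mu> - R \<mu> (\<phi> (X i)))"
        using elim reward_le_max[OF path(2), of \<mu>] by simp
      then show ?case using suboptimality_eq[OF p(1), of "X i"] p(2) by simp
    qed
    have "((\<lambda>i. DK \<mu> p (\<phi> (X i))) \<longlongrightarrow> 0) F"
      by (rule tendsto_sandwich[OF always_eventually upper tendsto_const lim0])
        (simp add: DK_nonneg[OF optimalD(1)[OF p(1)] path(1)])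
    then have "((\<lambda>i. \<phi> (X i) $ s) \<longlongrightarrow> p $ s) F"
      by (rule DK_tendsto_0_imp_tendsto[OF optimalD(1)[OF p(1)] path(1) _ p(3)])
    moreover have "((\<lambda>i. \<phi> (X i) $ s) \<longlongrightarrow> q $ s) F"
      by (intro tendsto_intros q)
    ultimately show ?thesis using tendsto_unique[OF F] by blast
  qed
qed

lemma occupancy_pos_of_full_support:
  assumes p: "p \<in> policies" and \<mu>: "0 < pmf \<mu> s"
  shows "0 < occupancy \<mu> p s"
proof -
  have "0 < (1 - \<gamma>) * pmf \<mu> s" using discount \<mu> by simp
  also have "\<dots> \<le> occupancy \<mu> p s"
    unfolding state_dist_balance[OF discount p, of P \<mu> s]
    using discount policiesD(1)[OF p]
    by (simp add: sum_nonneg state_dist_nonneg)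
  finally show ?thesis .
qed

text \<open>
  Under the given initial distribution, optimal policies may leave states unvisited, and there the
  divergence gives no control. The path is the same for every initial distribution, though, so it
  suffices to argue with the uniform one, for which all policies visit all states and the minimiser
  is unique.
\<close>

lemma path_convergent: "\<exists>q. (\<phi> \<longlongrightarrow> q) at_top"
proof -
  define \<nu> :: "'s pmf" where "\<nu> = pmf_of_set UNIV"
  obtain p where p: "p \<in> optimal \<nu>" "DK \<nu> p p0 = Dmin \<nu>" using min_div_attained by blast
  have d: "0 < occupancy \<nu> p s" for s
    by (rule occupancy_pos_of_full_support[OF optimalD(1)[OF p(1)]]) (simp add: \<nu>_def)
  have "(\<phi> \<longlongrightarrow> p) at_top"
  proof (rule tendsto_at_top_if_unique_cluster_point[OF compact_policies path(2)])
    fix X q assume "filterlim X at_top sequentially" "(\<lambda>n. \<phi> (X n)) \<longlonglongrightarrow> q"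
    from path_cluster_point_eq[OF this(1) sequentially_bot this(2) p d]
    show "q = p" by (simp add: vec_eq_iff)
  qed
  then show ?thesis by blast
qed

text \<open>
  Where the limit \<open>q\<close> is compared with another minimiser \<open>p\<close>, the cluster point lemma speaks of the
  states that \<open>p\<close> visits; agreement on these makes the two occupancies equal, so these are also the
  states that \<open>q\<close> visits.
\<close>

lemma path_limit:
  assumes lim: "(\<phi> \<longlongrightarrow> q) at_top"
  shows "is_arg_min (\<lambda>p. DK \<mu> p p0) (\<lambda>p. p \<in> optimal \<mu>) q"
    and "is_arg_min (\<lambda>p. DK \<mu> p p0) (\<lambda>p. p \<in> optimal \<mu>) p \<Longrightarrow> 0 < occupancy \<mu> q s \<Longrightarrow> p $ s = q $ s"
proof -
  note cluster = path_cluster_point[OF filterlim_ident trivial_limit_at_top_linorder lim, where \<mu> = \<mu>]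
  show "is_arg_min (\<lambda>p. DK \<mu> p p0) (\<lambda>p. p \<in> optimal \<mu>) q"
    using cluster(1,2) by (simp add: is_arg_min_div_iff)
  assume "is_arg_min (\<lambda>p. DK \<mu> p p0) (\<lambda>p. p \<in> optimal \<mu>) p" and pos: "0 < occupancy \<mu> q s"
  then have p: "p \<in> optimal \<mu>" "DK \<mu> p p0 = Dmin \<mu>" by (simp_all add: is_arg_min_div_iff)
  have eq: "q $ s = p $ s" if "0 < occupancy \<mu> p s" for s
    using cluster(3)[OF p that] by simp
  then have "occupancy \<mu> q = occupancy \<mu> p"
    by (intro occupancy_cong optimalD(1)[OF cluster(1)] optimalD(1)[OF p(1)])
  with pos eq show "p $ s = q $ s" by simp
qed

end

end

theorem theorem3p9:
  fixes P :: "'s::finite \<Rightarrow> 'a::finite \<Rightarrow> 's pmf"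
    and r :: "'s \<Rightarrow> 'a \<Rightarrow> real"
    and \<gamma> :: real
    and \<mu> :: "'s pmf"
    and \<pi>\<^sub>0 :: "real ^ 'a ^ 's"
  assumes "0 \<le> \<gamma>" and "\<gamma> < 1"
    and "\<forall>\<pi>\<in>rel_interior (policies :: (real ^ 'a ^ 's) set). \<forall>s. 0 < state_dist P \<gamma> \<mu> \<pi> s"
    and "\<pi>\<^sub>0 \<in> rel_interior policies"
  shows "\<exists>\<phi>. kakade_flow P r \<gamma> \<mu> \<pi>\<^sub>0 \<phi> \<and>
    (\<forall>\<psi>. kakade_flow P r \<gamma> \<mu> \<pi>\<^sub>0 \<psi> \<longrightarrow> (\<forall>t\<ge>0. \<psi> t = \<phi> t)) \<and>
    (\<forall>t>0. \<forall>\<pi>. is_arg_max (\<lambda>\<pi>. reward P r \<gamma> \<mu> \<pi> - kakade_div P \<gamma> \<mu> \<pi> \<pi>\<^sub>0 / t) (\<lambda>\<pi>. \<pi> \<in> policies) \<pi>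
       \<longleftrightarrow> \<pi> = \<phi> t) \<and>
    (\<forall>t>0.
       0 \<le> max_reward P r \<gamma> \<mu> - reward P r \<gamma> \<mu> (\<phi> t) \<and>
       max_reward P r \<gamma> \<mu> - reward P r \<gamma> \<mu> (\<phi> t)
         \<le> (min_optimal_div P r \<gamma> \<mu> \<pi>\<^sub>0 - kakade_div P \<gamma> \<mu> (\<phi> t) \<pi>\<^sub>0) / t \<and>
       (min_optimal_div P r \<gamma> \<mu> \<pi>\<^sub>0 - kakade_div P \<gamma> \<mu> (\<phi> t) \<pi>\<^sub>0) / t
         \<le> min_optimal_div P r \<gamma> \<mu> \<pi>\<^sub>0 / t) \<and>
    (\<exists>\<pi>'. (\<phi> \<longlongrightarrow> \<pi>') at_top \<and>
       is_arg_min (\<lambda>\<pi>. kakade_div P \<gamma> \<mu> \<pi> \<pi>\<^sub>0) (\<lambda>\<pi>. \<pi> \<in> optimal_policies P r \<gamma> \<mu>) \<pi>' \<and>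
       (\<forall>\<pi>. is_arg_min (\<lambda>\<pi>. kakade_div P \<gamma> \<mu> \<pi> \<pi>\<^sub>0) (\<lambda>\<pi>. \<pi> \<in> optimal_policies P r \<gamma> \<mu>) \<pi> \<longrightarrow>
          (\<forall>s. 0 < state_dist P \<gamma> \<mu> \<pi>' s \<longrightarrow> \<pi> $ s = \<pi>' $ s)))"
proof -
  interpret discounted_mdp P r \<gamma> by unfold_locales (fact assms)+
  have int: "positive_policies = rel_interior (policies :: (real ^ 'a ^ 's) set)"
    by (simp add: rel_interior_policies positive_policies_def)
  have p0: "\<pi>\<^sub>0 \<in> positive_policies" using assms(4) by (simp add: int)
  have d: "0 < state_dist P \<gamma> \<mu> p s" if "p \<in> positive_policies" for p s
    using assms(3) that by (simp add: int)
  obtain q where q: "(soft_policy \<pi>\<^sub>0 \<longlongrightarrow> q) at_top" using path_convergent[OF p0] by blast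
  show ?thesis
  proof (intro exI[of _ "soft_policy \<pi>\<^sub>0"] conjI allI impI exI[of _ q])
    show "kakade_flow P r \<gamma> \<mu> \<pi>\<^sub>0 (soft_policy \<pi>\<^sub>0)"
      by (rule soft_policy_is_kakade_flow[OF p0 d])
    show "\<psi> t = soft_policy \<pi>\<^sub>0 t" if "kakade_flow P r \<gamma> \<mu> \<pi>\<^sub>0 \<psi>" "0 \<le> t" for \<psi> t
      by (rule kakade_flow_unique[OF p0 d that])
    show "is_arg_max (\<lambda>\<pi>. reward P r \<gamma> \<mu> \<pi> - kakade_div P \<gamma> \<mu> \<pi> \<pi>\<^sub>0 / t) (\<lambda>\<pi>. \<pi> \<in> policies) \<pi>
        \<longleftrightarrow> \<pi> = soft_policy \<pi>\<^sub>0 t" if "0 < t" for t \<pi>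
      by (rule central_path[OF p0 d[OF soft_policy_positive[OF p0]] that])
  next
    fix t :: real assume t: "0 < t"
    note pol = soft_policy_policies[OF p0, of t]
    show "0 \<le> max_reward P r \<gamma> \<mu> - reward P r \<gamma> \<mu> (soft_policy \<pi>\<^sub>0 t)"
      using reward_le_max[OF p0 pol] by simp
    show "max_reward P r \<gamma> \<mu> - reward P r \<gamma> \<mu> (soft_policy \<pi>\<^sub>0 t)
        \<le> (min_optimal_div P r \<gamma> \<mu> \<pi>\<^sub>0 - kakade_div P \<gamma> \<mu> (soft_policy \<pi>\<^sub>0 t) \<pi>\<^sub>0) / t"
      by (rule suboptimality_le[OF p0 t])
    show "(min_optimal_div P r \<gamma> \<mu> \<pi>\<^sub>0 - kakade_div P \<gamma> \<mu> (soft_policy \<pi>\<^sub>0 t) \<pi>\<^sub>0) / t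
        \<le> min_optimal_div P r \<gamma> \<mu> \<pi>\<^sub>0 / t"
      using t DK_nonneg[OF pol p0] by (intro divide_right_mono) auto
  next
    show "(soft_policy \<pi>\<^sub>0 \<longlongrightarrow> q) at_top" by (rule q)
    show "is_arg_min (\<lambda>\<pi>. kakade_div P \<gamma> \<mu> \<pi> \<pi>\<^sub>0) (\<lambda>\<pi>. \<pi> \<in> optimal_policies P r \<gamma> \<mu>) q"
      by (rule path_limit(1)[OF p0 q])
    show "\<pi> $ s = q $ s"
      if "is_arg_min (\<lambda>\<pi>. kakade_div P \<gamma> \<mu> \<pi> \<pi>\<^sub>0) (\<lambda>\<pi>. \<pi> \<in> optimal_policies P r \<gamma> \<mu>) \<pi>"
        "0 < state_dist P \<gamma> \<mu> q s" for \<pi> s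
      by (rule path_limit(2)[OF p0 q that])
  qed
qed

end
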